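(* Let $n\ge2$ and let $G\subset\mathbb{R}^n$ be a John domain with $\operatorname{diam}(G)\le4$ such that $$\limsup_{k\to\infty}2^{-\lambda k}\,\sharp\mathcal{W}_k>0,$$ where $\lambda=\dim_{\mathcal{M}}(\partial G)$. Suppose that $$p\le\frac{q(n-\lambda b)}{q+b(n-\lambda)},\qquad b=\frac{2\beta}{1+\beta},$$ where $1\le q<p<\infty$ and $\beta\in(0,1]$. Then the $\beta$-version $G_\beta$ of $G$ does not satisfy the $(q,p)$-Poincaré inequality.
   Context: A domain is an open connected set. A bounded domain $D$ satisfies the $(q,p)$-Poincaré inequality if there is a finite constant $c$ such that $\left(\int_D|u-u_D|^q\,dx\right)^{1/q}\le c\left(\int_D|\nabla u|^p\,dx\right)^{1/p}$ for all $u$ in the Sobolev space $W^{1,p}(D)$, where $u_D$ is the integral average of $u$ over $D$. John domain: a bounded domain $G\subset\mathbb{R}^n$ is a John domain if there exist $x_0\in G$ and $c_J\in(0,1]$ such that every $x\in G$ can be joined to $x_0$ by a rectifiable curve $\gamma:[0,\ell(\gamma)]\to G$ parametrized by arc length with $\gamma(0)=x$, $\gamma(\ell(\gamma))=x_0$ and $\operatorname{dist}(\gamma(t),\partial G)\ge c_Jt$ for each $t\in[0,\ell(\gamma)]$. Upper Minkowski dimension of $E\subset\mathbb{R}^n$: $\dim_{\mathcal{M}}(E)=\sup\{\lambda\ge0:\limsup_{r\to0+}\mathcal{M}_\lambda(E,r)=\infty\}$, where $\mathcal{M}_\lambda(E,r)=\left|\bigcup_{x\in E}B^n(x,r)\right|/r^{n-\lambda}$.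 Whitney decomposition: for each domain $G$ a Whitney decomposition $\mathcal{W}=\mathcal{W}_G$ (as constructed in Stein's book) is fixed: a family of closed dyadic cubes with pairwise disjoint interiors and union $G$, such that $\operatorname{diam}(Q)\le\operatorname{dist}(Q,\partial G)\le4\operatorname{diam}(Q)$ for each $Q\in\mathcal{W}$, and $\sum_{Q\in\mathcal{W}}\chi_{Q^*}\le12^n$ with $Q^*=\frac98Q$. $\mathcal{W}_k$ is the family of cubes in $\mathcal{W}$ with side length $2^{-k}$ and $\sharp\mathcal{W}_k$ is their number. $\beta$-version: let $\beta\in(0,1]$ and let $Q=\prod_{i=1}^n[x_i-\ell/2,x_i+\ell/2]$ be a closed cube with side length $\ell\le4$. Put - room: $R(Q)=\prod_{i=1}^n(x_i-\ell/8,x_i+\ell/8)$; - $\beta$-passage: $P_\beta(Q)=\Big(\prod_{i=1}^{n-1}(x_i-(\ell/8)^{1/\beta},x_i+(\ell/8)^{1/\beta})\Big)\times(x_n+\ell/8,\,x_n+\ell/8+(\ell/8)^{1/\beta})$; - long $\beta$-passage: $L_\beta(Q)=\Big(\prod_{i=1}^{n-1}(x_i-(\ell/8)^{1/\beta},x_i+(\ell/8)^{1/\beta})\Big)\times(x_n,x_n+\ell/2)$; - $\beta$-apartment: $A_\beta(Q)=L_\beta(Q)\cup\big(Q\setminus(\partial R(Q)\cup\partial P_\beta(Q))\big)$. The $\beta$-version of a John domain $G$ (with $\operatorname{diam}(G)\le4$) is the domain $G_\beta=\bigcup_{Q\in\mathcal{W}_G}A_\beta(Q)$. *)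

theory Defs
  imports "HOL-Analysis.Analysis"
begin

definition domain :: "'a::topological_space set \<Rightarrow> bool"
  where "domain D \<longleftrightarrow> open D \<and> connected D"

subsection \<open>Sobolev functions and the Poincare inequality\<close>

definition partial_deriv :: "'n::finite \<Rightarrow> (real^'n \<Rightarrow> real) \<Rightarrow> real^'n \<Rightarrow> real"
  where "partial_deriv i f x = frechet_derivative f (at x) (axis i 1)"

primrec Ck :: "nat \<Rightarrow> (real^'n::finite \<Rightarrow> real) \<Rightarrow> bool"
  where
    "Ck 0 f \<longleftrightarrow> continuous_on UNIV f"
  | "Ck (Suc k) f \<longleftrightarrow> (\<forall>x. f differentiable (at x)) \<and> (\<forall>i. Ck k (partial_deriv i f))"

definition test_function :: "(real^'n::finite) set \<Rightarrow> (real^'n \<Rightarrow> real) \<Rightarrow> bool"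
  where "test_function D \<phi> \<longleftrightarrow>
    (\<forall>k. Ck k \<phi>) \<and> compact (closure {x. \<phi> x \<noteq> 0}) \<and> closure {x. \<phi> x \<noteq> 0} \<subseteq> D"

definition in_Lp :: "real \<Rightarrow> (real^'n::finite) set \<Rightarrow> (real^'n \<Rightarrow> 'b::euclidean_space) \<Rightarrow> bool"
  where "in_Lp p D f \<longleftrightarrow>
    f \<in> borel_measurable (lebesgue_on D) \<and> integrable (lebesgue_on D) (\<lambda>x. norm (f x) powr p)"

definition Lp_norm :: "real \<Rightarrow> (real^'n::finite) set \<Rightarrow> (real^'n \<Rightarrow> 'b::euclidean_space) \<Rightarrow> real"
  where "Lp_norm p D f = (integral\<^sup>L (lebesgue_on D) (\<lambda>x. norm (f x) powr p)) powr (1 / p)"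

definition weak_gradient ::
    "(real^'n::finite) set \<Rightarrow> (real^'n \<Rightarrow> real) \<Rightarrow> (real^'n \<Rightarrow> real^'n) \<Rightarrow> bool"
  where "weak_gradient D u g \<longleftrightarrow>
    (\<forall>\<phi> i. test_function D \<phi> \<longrightarrow>
      integral\<^sup>L (lebesgue_on D) (\<lambda>x. u x * partial_deriv i \<phi> x) =
      - integral\<^sup>L (lebesgue_on D) (\<lambda>x. g x $ i * \<phi> x))"

text \<open>\<open>u\<close> belongs to \<open>W\<^sup>1\<^sup>,\<^sup>p(D)\<close> with weak gradient \<open>g\<close>.\<close>

definition sobolev_W1p ::
    "real \<Rightarrow> (real^'n::finite) set \<Rightarrow> (real^'n \<Rightarrow> real) \<Rightarrow> (real^'n \<Rightarrow> real^'n) \<Rightarrow> bool"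
  where "sobolev_W1p p D u g \<longleftrightarrow> in_Lp p D u \<and> in_Lp p D g \<and> weak_gradient D u g"

definition average :: "(real^'n::finite) set \<Rightarrow> (real^'n \<Rightarrow> real) \<Rightarrow> real"
  where "average D u = integral\<^sup>L (lebesgue_on D) u / measure lebesgue D"

text \<open>The Bochner integral of a non-integrable function is \<open>0\<close>. As the right-hand side below is
  finite, finiteness of the left-hand side is part of the inequality and is required explicitly.\<close>

definition poincare :: "real \<Rightarrow> real \<Rightarrow> (real^'n::finite) set \<Rightarrow> bool"
  where "poincare q p D \<longleftrightarrow>
    (\<exists>c. \<forall>u g. sobolev_W1p p D u g \<longrightarrow>
      in_Lp q D (\<lambda>x. u x - average D u) \<and>
      Lp_norm q D (\<lambda>x. u x - average D u) \<le> c * Lp_norm p D g)"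

subsection \<open>John domains\<close>

definition curve_length :: "(real \<Rightarrow> 'a::metric_space) \<Rightarrow> real \<Rightarrow> real \<Rightarrow> ennreal"
  where "curve_length \<gamma> a b =
    Sup {ennreal (\<Sum>i<m. dist (\<gamma> (t i)) (\<gamma> (t (Suc i)))) | (m::nat) t.
           t 0 = a \<and> t m = b \<and> (\<forall>i<m. t i \<le> t (Suc i))}"

definition arc_length_curve :: "real \<Rightarrow> (real \<Rightarrow> 'a::metric_space) \<Rightarrow> bool"
  where "arc_length_curve L \<gamma> \<longleftrightarrow>
    0 \<le> L \<and> continuous_on {0..L} \<gamma> \<and> (\<forall>t\<in>{0..L}. curve_length \<gamma> 0 t = ennreal t)"

definition john_domain :: "(real^'n::finite) set \<Rightarrow> bool"
  where "john_domain G \<longleftrightarrow>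
    domain G \<and> bounded G \<and>
    (\<exists>x0\<in>G. \<exists>c. 0 < c \<and> c \<le> 1 \<and>
      (\<forall>x\<in>G. \<exists>L \<gamma>. arc_length_curve L \<gamma> \<and> \<gamma> ` {0..L} \<subseteq> G \<and> \<gamma> 0 = x \<and> \<gamma> L = x0 \<and>
        (\<forall>t\<in>{0..L}. c * t \<le> infdist (\<gamma> t) (frontier G))))"

subsection \<open>Upper Minkowski dimension\<close>

definition minkowski_content :: "real \<Rightarrow> (real^'n::finite) set \<Rightarrow> real \<Rightarrow> ennreal"
  where "minkowski_content s E r =
    emeasure lebesgue (\<Union>x\<in>E. ball x r) / ennreal (r powr (real CARD('n) - s))"

definition upper_minkowski_dim :: "(real^'n::finite) set \<Rightarrow> ennreal"
  where "upper_minkowski_dim E =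
    Sup {ennreal s | s. 0 \<le> s \<and> Limsup (at_right 0) (minkowski_content s E) = \<infinity>}"

subsection \<open>Whitney decompositions\<close>

definition cube :: "real^'n::finite \<Rightarrow> real \<Rightarrow> (real^'n) set"
  where "cube x l = {y. \<forall>i. x $ i - l / 2 \<le> y $ i \<and> y $ i \<le> x $ i + l / 2}"

definition dyadic_cube :: "(real^'n::finite) set \<Rightarrow> bool"
  where "dyadic_cube Q \<longleftrightarrow>
    (\<exists>(j::int) (z :: int^'n).
      Q = {y. \<forall>i. 2 powi j * of_int (z $ i) \<le> y $ i \<and> y $ i \<le> 2 powi j * (of_int (z $ i) + 1)})"

text \<open>The last clause says that the concentric cubes \<open>Q\<^sup>* = (9/8) Q\<close> have overlap at most
  \<open>12\<^sup>n\<close>.\<close>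

definition whitney :: "(real^'n::finite) set \<Rightarrow> (real^'n) set set \<Rightarrow> bool"
  where "whitney G W \<longleftrightarrow>
    (\<forall>Q\<in>W. dyadic_cube Q) \<and>
    pairwise (\<lambda>Q Q'. interior Q \<inter> interior Q' = {}) W \<and>
    \<Union>W = G \<and>
    (\<forall>Q\<in>W. diameter Q \<le> setdist Q (frontier G) \<and> setdist Q (frontier G) \<le> 4 * diameter Q) \<and>
    (\<forall>y. let S = {Q \<in> W. \<exists>x l. 0 < l \<and> Q = cube x l \<and> y \<in> cube x (9 / 8 * l)}
         in finite S \<and> card S \<le> 12 ^ CARD('n))"

definition whitney_layer :: "(real^'n::finite) set set \<Rightarrow> nat \<Rightarrow> (real^'n) set set"
  where "whitney_layer W k = {Q \<in> W. \<exists>x. Q = cube x (1 / 2 ^ k)}"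

subsection \<open>The beta-version of a domain\<close>

text \<open>The sets below are attached to the cube with centre \<open>x\<close> and side length \<open>l\<close>. The index \<open>m\<close>
  is the coordinate called \<open>n\<close> (the last one) in the informal definition; the type of indices
  carries no order, so it is a parameter.\<close>

definition room :: "real^'n::finite \<Rightarrow> real \<Rightarrow> (real^'n) set"
  where "room x l = {y. \<forall>i. x $ i - l / 8 < y $ i \<and> y $ i < x $ i + l / 8}"

definition passage :: "'n \<Rightarrow> real \<Rightarrow> real^'n::finite \<Rightarrow> real \<Rightarrow> (real^'n) set"
  where "passage m \<beta> x l =
    {y. (\<forall>i. i \<noteq> m \<longrightarrow>
           x $ i - (l / 8) powr (1 / \<beta>) < y $ i \<and> y $ i < x $ i + (l / 8) powr (1 / \<beta>)) \<and>
        x $ m + l / 8 < y $ m \<and> y $ m < x $ m + l / 8 + (l / 8) powr (1 / \<beta>)}"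

definition long_passage :: "'n \<Rightarrow> real \<Rightarrow> real^'n::finite \<Rightarrow> real \<Rightarrow> (real^'n) set"
  where "long_passage m \<beta> x l =
    {y. (\<forall>i. i \<noteq> m \<longrightarrow>
           x $ i - (l / 8) powr (1 / \<beta>) < y $ i \<and> y $ i < x $ i + (l / 8) powr (1 / \<beta>)) \<and>
        x $ m < y $ m \<and> y $ m < x $ m + l / 2}"

definition apartment :: "'n \<Rightarrow> real \<Rightarrow> real^'n::finite \<Rightarrow> real \<Rightarrow> (real^'n) set"
  where "apartment m \<beta> x l =
    long_passage m \<beta> x l \<union> (cube x l - (frontier (room x l) \<union> frontier (passage m \<beta> x l)))"

definition beta_version :: "'n \<Rightarrow> real \<Rightarrow> (real^'n::finite) set set \<Rightarrow> (real^'n) set"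
  where "beta_version m \<beta> W = \<Union>{apartment m \<beta> x l | x l. 0 < l \<and> cube x l \<in> W}"

end

theory Submission
  imports Defs
begin

text \<open>
  For a single layer of Whitney cubes of side \<open>l = 2\<^sup>-\<^sup>k\<close>, let \<open>u\<close> be \<open>1\<close> on the rooms, decrease
  linearly to \<open>0\<close> along the passages, whose width and height are comparable to
  \<open>h = (l/8)\<^sup>1\<^sup>/\<^sup>\<beta>\<close>, and vanish elsewhere. With \<open>N\<close> cubes in the layer, \<open>\<parallel>u - u\<^sub>D\<parallel>\<^sub>q\<close> is at least a
  constant times \<open>(N l\<^sup>n)\<^sup>1\<^sup>/\<^sup>q\<close> and \<open>\<parallel>\<nabla>u\<parallel>\<^sub>p\<close> at most a constant times \<open>(N h\<^sup>n\<^sup>-\<^sup>p)\<^sup>1\<^sup>/\<^sup>p\<close>. Since \<open>N\<close> is at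
  least a constant times \<open>l\<^sup>-\<^sup>\<lambda>\<close> for infinitely many \<open>k\<close>, this excludes the inequality for
  \<open>p < q (n - \<lambda>\<beta>) / (q + \<beta> (n - \<lambda>))\<close>. The right-hand side decreases strictly in \<open>\<beta>\<close>, and \<open>q < p\<close>
  forces \<open>\<beta> < 1\<close>, hence \<open>\<beta> < b\<close>, so the hypothesis on \<open>p\<close> implies this bound.
  That \<open>\<lambda> \<le> n\<close> follows by comparing the volume of the layer with that of \<open>G\<close>.
\<close>

section \<open>Weak gradients of locally Lipschitz functions\<close>

lemma test_function_has_derivative:
  fixes \<phi> :: "real^'n::finite \<Rightarrow> real"
  assumes "test_function D \<phi>"
  shows "(\<phi> has_derivative (\<lambda>h. \<Sum>i\<in>UNIV. h $ i * partial_deriv i \<phi> x)) (at x)"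
proof -
  have "Ck (Suc 0) \<phi>"
    using assms unfolding test_function_def by blast
  then have d: "(\<phi> has_derivative frechet_derivative \<phi> (at x)) (at x)"
    using frechet_derivative_works by auto
  then interpret bounded_linear "frechet_derivative \<phi> (at x)"
    by (rule has_derivative_bounded_linear)
  have "frechet_derivative \<phi> (at x) h = (\<Sum>i\<in>UNIV. h $ i * partial_deriv i \<phi> x)" for h
  proof -
    have "frechet_derivative \<phi> (at x) h = frechet_derivative \<phi> (at x) (\<Sum>i\<in>UNIV. (h $ i) *\<^sub>R axis i 1)"
      using basis_expansion[of h] by (simp add: scalar_mult_eq_scaleR)
    also have "\<dots> = (\<Sum>i\<in>UNIV. h $ i * partial_deriv i \<phi> x)"
      by (simp add: sum scaleR partial_deriv_def)
    finally show ?thesis .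
  qed
  then have "frechet_derivative \<phi> (at x) = (\<lambda>h. \<Sum>i\<in>UNIV. h $ i * partial_deriv i \<phi> x)"
    by (rule ext)
  with d show ?thesis
    by simp
qed

lemma test_function_continuous_partial_deriv:
  assumes "test_function D \<phi>"
  shows "continuous_on UNIV (partial_deriv i \<phi>)"
proof -
  have "Ck (Suc 0) \<phi>"
    using assms unfolding test_function_def by blast
  then show ?thesis
    by simp
qed

lemma partial_deriv_outside_support:
  assumes "x \<notin> closure {x. \<phi> x \<noteq> 0}"
  shows "partial_deriv i \<phi> x = 0"
proof -
  have "((\<lambda>_. 0) has_derivative (\<lambda>_. 0)) (at x)"
    by simp
  then have "(\<phi> has_derivative (\<lambda>_. 0)) (at x)"
    by (rule has_derivative_transform_within_open[of _ _ _ _ "- closure {x. \<phi> x \<noteq> 0}"])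
      (use assms closure_subset[of "{x. \<phi> x \<noteq> 0}"] in auto)
  then show ?thesis
    by (simp add: partial_deriv_def frechet_derivative_at[symmetric])
qed

text \<open>The partial derivatives are continuous and vanish off the compact support, so they are
  bounded on the whole space, and the mean value inequality applies.\<close>

lemma test_function_lipschitz:
  fixes \<phi> :: "real^'n::finite \<Rightarrow> real"
  assumes \<phi>: "test_function D \<phi>"
  obtains C where "C-lipschitz_on UNIV \<phi>"
proof -
  define K where "K = closure {x. \<phi> x \<noteq> 0}"
  have "compact K"
    using \<phi> by (simp add: test_function_def K_def)
  have "\<exists>B. \<forall>x. \<bar>partial_deriv i \<phi> x\<bar> \<le> B" for i
  proof -
    have "bounded (partial_deriv i \<phi> ` K)"
      using \<open>compact K\<close> test_function_continuous_partial_deriv[OF \<phi>]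
      by (meson compact_continuous_image compact_imp_bounded continuous_on_subset subset_UNIV)
    then obtain B where "\<forall>x\<in>K. \<bar>partial_deriv i \<phi> x\<bar> \<le> B"
      by (auto simp: bounded_iff)
    then have "\<bar>partial_deriv i \<phi> x\<bar> \<le> max 0 B" for x
      using partial_deriv_outside_support[of x \<phi> i] by (cases "x \<in> K") (auto simp: K_def)
    then show ?thesis
      by blast
  qed
  then obtain B where B: "\<And>i x. \<bar>partial_deriv i \<phi> x\<bar> \<le> B i"
    by metis
  have "(\<Sum>i\<in>UNIV. B i)-lipschitz_on UNIV \<phi>"
  proof (rule bounded_derivative_imp_lipschitz)
    show "(\<phi> has_derivative (\<lambda>h. \<Sum>i\<in>UNIV. h $ i * partial_deriv i \<phi> x)) (at x within UNIV)" for x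
      by (rule test_function_has_derivative[OF \<phi>])
    show "onorm (\<lambda>h. \<Sum>i\<in>UNIV. h $ i * partial_deriv i \<phi> x) \<le> (\<Sum>i\<in>UNIV. B i)" for x
    proof (rule onorm_le)
      fix h :: "real^'n"
      have "norm (\<Sum>i\<in>UNIV. h $ i * partial_deriv i \<phi> x) \<le> (\<Sum>i\<in>UNIV. \<bar>h $ i\<bar> * \<bar>partial_deriv i \<phi> x\<bar>)"
        by (simp add: abs_mult[symmetric] sum_abs)
      also have "\<dots> \<le> (\<Sum>i\<in>UNIV. norm h * B i)"
        by (intro sum_mono mult_mono component_le_norm_cart B) auto
      finally show "norm (\<Sum>i\<in>UNIV. h $ i * partial_deriv i \<phi> x) \<le> (\<Sum>i\<in>UNIV. B i) * norm h"
        by (simp add: sum_distrib_left mult.commute)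
    qed
    show "0 \<le> (\<Sum>i\<in>UNIV. B i)"
      by (intro sum_nonneg) (use B in \<open>meson abs_ge_zero order_trans\<close>)
  qed simp
  with that show ?thesis .
qed

section \<open>Products, translations and compact supports\<close>

lemma lipschitz_on_mult_bounded:
  fixes f g :: "'a::metric_space \<Rightarrow> real"
  assumes f: "L-lipschitz_on X f" and g: "M-lipschitz_on X g"
    and bf: "\<And>x. x \<in> X \<Longrightarrow> \<bar>f x\<bar> \<le> A" and bg: "\<And>x. x \<in> X \<Longrightarrow> \<bar>g x\<bar> \<le> B" and "0 \<le> A" "0 \<le> B"
  shows "(A * M + B * L)-lipschitz_on X (\<lambda>x. f x * g x)"
proof (rule lipschitz_onI)
  fix x y assume xy: "x \<in> X" "y \<in> X"
  have "dist (f x * g x) (f y * g y) = \<bar>f x * (g x - g y) + g y * (f x - f y)\<bar>"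
    by (simp add: dist_real_def algebra_simps)
  also have "\<dots> \<le> \<bar>f x\<bar> * \<bar>g x - g y\<bar> + \<bar>g y\<bar> * \<bar>f x - f y\<bar>"
    by (metis abs_mult abs_triangle_ineq)
  also have "\<dots> \<le> A * (M * dist x y) + B * (L * dist x y)"
    using lipschitz_onD[OF f xy] lipschitz_onD[OF g xy] xy \<open>0 \<le> A\<close> \<open>0 \<le> B\<close>
    by (intro add_mono mult_mono bf bg) (auto simp: dist_real_def)
  finally show "dist (f x * g x) (f y * g y) \<le> (A * M + B * L) * dist x y"
    by (simp add: algebra_simps)
qed (use lipschitz_on_nonneg[OF f] lipschitz_on_nonneg[OF g] assms in simp)

text \<open>For Borel \<open>v\<close> both claims reduce from the completed measure to
  \<open>lborel\<close>, whose image under a translation is itself.\<close>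

lemma lebesgue_integral_translate:
  fixes v :: "'a::euclidean_space \<Rightarrow> real"
  assumes [measurable]: "v \<in> borel_measurable borel"
  shows "integral\<^sup>L lebesgue (\<lambda>x. v (x + a)) = integral\<^sup>L lebesgue v"
    and "integrable lebesgue (\<lambda>x. v (x + a)) \<longleftrightarrow> integrable lebesgue v"
proof -
  have "integral\<^sup>L lborel (\<lambda>x. v (a + x)) = integral\<^sup>L (distr lborel borel ((+) a)) v"
    by (intro integral_distr[symmetric]) auto
  moreover have "integrable lborel (\<lambda>x. v (a + x)) = integrable (distr lborel borel ((+) a)) v"
    by (intro integrable_distr_eq[symmetric]) auto
  ultimately show "integral\<^sup>L lebesgue (\<lambda>x. v (x + a)) = integral\<^sup>L lebesgue v"
    and "integrable lebesgue (\<lambda>x. v (x + a)) \<longleftrightarrow> integrable lebesgue v"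
    by (simp_all add: lborel_distr_plus integral_completion integrable_completion add.commute)
qed

lemma integrable_lebesgue_bounded_support:
  fixes f :: "'a::euclidean_space \<Rightarrow> real"
  assumes "f \<in> borel_measurable lebesgue" "\<And>x. \<bar>f x\<bar> \<le> C * indicator (cball 0 r) x"
  shows "integrable lebesgue f"
proof (rule Bochner_Integration.integrable_bound)
  show "integrable lebesgue (\<lambda>x::'a. C * indicator (cball 0 r) x)"
    using lmeasurable_cball[of "0::'a" r] by (intro integrable_mult_right) (auto simp: fmeasurable_def)
qed (use assms in \<open>auto intro!: AE_I2 order_trans[OF assms(2)]\<close>)

text \<open>Compactness gives a Lipschitz constant on a ball reaching one unit beyond the support. A
  point outside that ball has distance at least 1 from every point where \<open>v\<close> is
  nonzero, so there a bound for \<open>v\<close> acts as a Lipschitz constant.\<close>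

lemma locally_lipschitz_compact_support:
  fixes v :: "'a::euclidean_space \<Rightarrow> real"
  assumes loc: "\<And>x. \<exists>r>0. \<exists>L. L-lipschitz_on (ball x r) v"
    and supp: "\<And>x. v x \<noteq> 0 \<Longrightarrow> norm x \<le> M"
  obtains C where "C-lipschitz_on UNIV v"
proof -
  define X where "X = cball (0::'a) (M + 1)"
  \<comment> \<open>\<open>local_lipschitz\<close> speaks of families with a time parameter; a
    single time makes it a statement about \<open>v\<close>.\<close>
  have "local_lipschitz {0::real} X (\<lambda>_. v)"
  proof (rule local_lipschitzI)
    fix x
    obtain r L where r: "r > 0" "L-lipschitz_on (ball x r) v"
      using loc by blast
    have "L-lipschitz_on (cball x (r / 2) \<inter> X) v"
      by (rule lipschitz_on_subset[OF r(2)]) (use r(1) in auto)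
    with r(1) show "\<exists>u>0. \<exists>L. \<forall>t\<in>cball t u \<inter> {0}. L-lipschitz_on (cball x u \<inter> X) v" for t :: real
      by (intro exI[of _ "r / 2"]) auto
  qed
  then obtain C where C: "C-lipschitz_on X v"
    using local_lipschitz_compact_implies_lipschitz[of "{0::real}" X "\<lambda>_. v"] by (auto simp: X_def)
  have "bounded (v ` X)"
    using lipschitz_on_continuous_on[OF C]
    by (intro compact_imp_bounded compact_continuous_image) (auto simp: X_def)
  then obtain V where V: "V > 0" "\<And>x. x \<in> X \<Longrightarrow> \<bar>v x\<bar> \<le> V"
    unfolding bounded_pos by auto
  have "C \<ge> 0"
    using C lipschitz_on_nonneg by blast
  have far: "dist (v x) (v y) \<le> (C + V) * dist x y" if "y \<notin> X" for x y
  proof (cases "v x = 0")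
    case True
    then show ?thesis
      using that supp[of y] V \<open>C \<ge> 0\<close> by (cases "v y = 0") (auto simp: X_def)
  next
    case False
    have vy: "v y = 0"
      using that supp[of y] by (auto simp: X_def)
    have "norm x \<le> M"
      using False supp by blast
    then have "dist x y \<ge> 1"
      using that norm_triangle_ineq2[of y x] by (simp add: X_def dist_norm norm_minus_commute)
    moreover have "\<bar>v x\<bar> \<le> V"
      using \<open>norm x \<le> M\<close> by (intro V) (simp add: X_def)
    ultimately have "\<bar>v x\<bar> \<le> C + V" "C + V \<le> (C + V) * dist x y"
      using V(1) \<open>C \<ge> 0\<close> mult_left_mono[of 1 "dist x y" "C + V"] by auto
    with vy show ?thesis
      by (simp add: dist_real_def)
  qed
  have "(C + V)-lipschitz_on UNIV v"
  proof (rule lipschitz_onI)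
    fix x y
    consider "x \<in> X" "y \<in> X" | "x \<notin> X" | "y \<notin> X"
      by blast
    then show "dist (v x) (v y) \<le> (C + V) * dist x y"
    proof cases
      case 1
      then have "dist (v x) (v y) \<le> C * dist x y"
        using C lipschitz_onD by blast
      also have "\<dots> \<le> (C + V) * dist x y"
        using V(1) by (intro mult_right_mono) auto
      finally show ?thesis .
    next
      case 2
      then show ?thesis
        using far[of x y] by (simp add: dist_commute)
    qed (rule far)
  qed (use V(1) \<open>C \<ge> 0\<close> in simp)
  with that show ?thesis .
qed

text \<open>The product of a locally Lipschitz function with a test function is Lipschitz, so its
  difference quotients, whose integrals vanish by translation invariance, converge dominatedly.\<close>

lemma weak_gradient_locally_lipschitz:
  fixes u :: "real^'n::finite \<Rightarrow> real" and g :: "real^'n \<Rightarrow> real^'n"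
  assumes "D \<subseteq> \<Omega>" and D: "D \<in> sets lebesgue"
    and u: "u \<in> borel_measurable lebesgue" and g: "g \<in> borel_measurable lebesgue"
    and lip: "\<And>x. x \<in> \<Omega> \<Longrightarrow> \<exists>r>0. \<exists>L. L-lipschitz_on (ball x r) u"
    and N: "negligible N"
    and der: "\<And>x. x \<in> \<Omega> - N \<Longrightarrow> (u has_derivative (\<lambda>h. g x \<bullet> h)) (at x)"
  shows "weak_gradient D u g"
  unfolding weak_gradient_def
proof (intro allI impI)
  fix \<phi> i assume \<phi>: "test_function D \<phi>"
  define K where "K = closure {x. \<phi> x \<noteq> 0}"
  define v where "v = (\<lambda>x. u x * \<phi> x)"
  have K: "compact K" "K \<subseteq> D"
    using \<phi> by (auto simp: test_function_def K_def)
  have \<phi>0: "\<phi> x = 0" and \<phi>'0: "partial_deriv i \<phi> x = 0" if "x \<notin> K" for x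
    using that partial_deriv_outside_support[of x \<phi>] closure_subset[of "{x. \<phi> x \<noteq> 0}"]
    by (auto simp: K_def)
  obtain M where M: "M > 0" "\<And>x. x \<in> K \<Longrightarrow> norm x \<le> M"
    using compact_imp_bounded[OF K(1)] by (auto simp: bounded_pos)
  obtain L\<phi> where L\<phi>: "L\<phi>-lipschitz_on UNIV \<phi>"
    using test_function_lipschitz[OF \<phi>] .
  have [measurable]: "\<phi> \<in> borel_measurable borel" "partial_deriv i \<phi> \<in> borel_measurable borel"
    using lipschitz_on_continuous_on[OF L\<phi>] test_function_continuous_partial_deriv[OF \<phi>]
    by (auto intro: borel_measurable_continuous_onI)
  note [measurable] = u g
  have [measurable]: "\<phi> \<in> borel_measurable lebesgue" "partial_deriv i \<phi> \<in> borel_measurable lebesgue"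
    by (rule measurable_completion, simp)+

  \<comment> \<open>Near a point of \<open>K\<close> both factors are Lipschitz, hence bounded on a
    small ball; off \<open>K\<close> the product vanishes locally.\<close>
  have "\<exists>r>0. \<exists>L. L-lipschitz_on (ball x r) v" for x
  proof (cases "x \<in> K")
    case True
    then obtain r L where r: "r > 0" "L-lipschitz_on (ball x r) u"
      using lip K \<open>D \<subseteq> \<Omega>\<close> by blast
    have L: "L \<ge> 0" "L\<phi> \<ge> 0"
      using r L\<phi> lipschitz_on_nonneg by blast+
    have bd: "\<bar>f y\<bar> \<le> \<bar>f x\<bar> + L' * r" if "L'-lipschitz_on (ball x r) f" "y \<in> ball x r" "L' \<ge> 0"
      for f :: "real^'n \<Rightarrow> real" and L' y
    proof -
      have "\<bar>f y - f x\<bar> \<le> L' * dist y x"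
        using lipschitz_onD[OF that(1,2), of x] r(1) by (auto simp: dist_real_def)
      also have "\<dots> \<le> L' * r"
        using that by (intro mult_left_mono) (auto simp: dist_commute)
      finally show ?thesis
        by linarith
    qed
    have \<phi>r: "L\<phi>-lipschitz_on (ball x r) \<phi>"
      using L\<phi> lipschitz_on_subset by blast
    have "((\<bar>u x\<bar> + L * r) * L\<phi> + (\<bar>\<phi> x\<bar> + L\<phi> * r) * L)-lipschitz_on (ball x r) v"
      unfolding v_def
      using lipschitz_on_mult_bounded[OF r(2) \<phi>r bd[OF r(2)] bd[OF \<phi>r]] L r(1) by simp
    with r(1) show ?thesis
      by blast
  next
    case False
    moreover have "open (- K)"
      using K(1) compact_imp_closed by auto
    ultimately obtain r where r: "r > 0" "ball x r \<subseteq> - K"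
      by (meson ComplI open_contains_ball)
    then have "v y = 0" if "y \<in> ball x r" for y
      using that \<phi>0[of y] by (auto simp: v_def)
    then have "0-lipschitz_on (ball x r) v"
      by (auto intro!: lipschitz_onI)
    with r(1) show ?thesis
      by blast
  qed
  moreover have v0: "v x \<noteq> 0 \<Longrightarrow> norm x \<le> M" for x
    using \<phi>0[of x] M(2)[of x] by (cases "x \<in> K") (auto simp: v_def)
  ultimately obtain C where C: "C-lipschitz_on UNIV v"
    using locally_lipschitz_compact_support[of v M] by blast
  have "C \<ge> 0"
    using C lipschitz_on_nonneg by blast
  have vm [measurable]: "v \<in> borel_measurable borel"
    using lipschitz_on_continuous_on[OF C] by (rule borel_measurable_continuous_onI)
  have [measurable]: "(\<lambda>x. v (x + a)) \<in> borel_measurable lebesgue" "v \<in> borel_measurable lebesgue" for a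
    by (rule measurable_completion, simp)+
  have vint: "integrable lebesgue v"
  proof -
    have "bounded (v ` cball 0 M)"
      using lipschitz_on_continuous_on[OF C]
      by (meson compact_cball compact_continuous_image compact_imp_bounded continuous_on_subset subset_UNIV)
    then obtain B where "\<forall>x\<in>cball 0 M. \<bar>v x\<bar> \<le> B"
      by (auto simp: bounded_iff)
    then have "\<bar>v x\<bar> \<le> B * indicator (cball 0 M) x" for x
      using v0[of x] by (cases "x \<in> cball 0 M") auto
    then show ?thesis
      by (intro integrable_lebesgue_bounded_support[of _ B M]) auto
  qed

  \<comment> \<open>Difference quotients along axis \<open>i\<close>. The steps are never zero and
    at most 1, so the shifted support stays within radius \<open>M + 1\<close>.\<close>
  define e where "e = (\<lambda>j::nat. (1 / real (Suc j)) *\<^sub>R axis i 1 :: real^'n)"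
  define d where "d = (\<lambda>(j::nat) x. (v (x + e j) - v x) * real (Suc j))"
  define F where "F = (\<lambda>x. g x $ i * \<phi> x + u x * partial_deriv i \<phi> x)"
  have ne: "norm (e j) = 1 / real (Suc j)" for j
    by (simp add: e_def norm_axis_1)
  have ne1: "norm (e j) \<le> 1" for j
    unfolding ne by simp
  have dint: "integral\<^sup>L lebesgue (d j) = 0" for j
  proof -
    show ?thesis
      using vint lebesgue_integral_translate[OF vm, of "e j"] by (simp add: d_def)
  qed
  have dbound: "\<bar>d j x\<bar> \<le> C * indicator (cball 0 (M + 1)) x" for j x
  proof (cases "norm x \<le> M + 1")
    case True
    have "\<bar>v (x + e j) - v x\<bar> \<le> C * norm (e j)"
      using lipschitz_onD[OF C, of "x + e j" x] by (simp add: dist_norm)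
    then have "\<bar>v (x + e j) - v x\<bar> * real (Suc j) \<le> C * norm (e j) * real (Suc j)"
      by (intro mult_right_mono) auto
    also have "\<dots> = C"
      unfolding ne by simp
    finally show ?thesis
      using True by (simp add: d_def abs_mult)
  next
    case False
    then have "norm (x + e j) > M"
      using ne1[of j] norm_triangle_ineq2[of x "- e j"] by simp
    then have "v (x + e j) = 0" "v x = 0"
      using v0[of x] v0[of "x + e j"] False by auto
    then show ?thesis
      using False by (simp add: d_def)
  qed
  have dlim: "(\<lambda>j. d j x) \<longlonglongrightarrow> F x" if "x \<notin> N" for x
  proof -
    \<comment> \<open>Off \<open>K\<close> a point may lie outside \<open>\<Omega>\<close>, where
      nothing is known about \<open>u\<close>; there the derivative of \<open>v\<close> is 0 because
      \<open>v\<close> vanishes nearby.\<close>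
    have "(v has_derivative (\<lambda>h. if x \<in> K then u x * (\<Sum>i\<in>UNIV. h $ i * partial_deriv i \<phi> x) + (g x \<bullet> h) * \<phi> x else 0)) (at x)"
    proof (cases "x \<in> K")
      case True
      then have "x \<in> \<Omega> - N"
        using K(2) \<open>D \<subseteq> \<Omega>\<close> that by blast
      then show ?thesis
        using True has_derivative_mult[OF der test_function_has_derivative[OF \<phi>]] by (simp add: v_def)
    next
      case False
      have "open (- K)"
        using K(1) compact_imp_closed by auto
      have "((\<lambda>_. 0::real) has_derivative (\<lambda>_. 0)) (at x)"
        by simp
      then have "(v has_derivative (\<lambda>_. 0)) (at x)"
        by (rule has_derivative_transform_within_open[of _ _ _ _ "- K"])
          (use False \<open>open (- K)\<close> \<phi>0 in \<open>auto simp: v_def\<close>)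
      with False show ?thesis
        by simp
    qed
    then have *: "(v has_derivative (\<lambda>h. if x \<in> K then u x * (\<Sum>i\<in>UNIV. h $ i * partial_deriv i \<phi> x) + (g x \<bullet> h) * \<phi> x else 0))
        (at (x + 0 *\<^sub>R axis i 1))"
      by simp
    have line: "((\<lambda>t. x + t *\<^sub>R axis i 1) has_derivative (\<lambda>t. t *\<^sub>R axis i 1)) (at 0)"
      by (auto intro!: derivative_eq_intros)
    have "(\<Sum>j\<in>UNIV. (t *\<^sub>R axis i 1) $ j * c j) = t * c i" for t :: real and c
      by (simp add: axis_def if_distrib[of "\<lambda>z. t * z * _"] cong: if_cong)
    then have "((\<lambda>t. v (x + t *\<^sub>R axis i 1)) has_derivative (\<lambda>t. F x * t)) (at 0)"
      by (intro has_derivative_eq_rhs[OF has_derivative_compose[OF line *]])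
        (auto simp: F_def \<phi>0 \<phi>'0 fun_eq_iff inner_axis algebra_simps simp del: vector_scaleR_component)
    then have "((\<lambda>t. v (x + t *\<^sub>R axis i 1)) has_field_derivative F x) (at 0)"
      by (simp add: has_field_derivative_def)
    then have "((\<lambda>t. (v (x + t *\<^sub>R axis i 1) - v x) / t) \<longlongrightarrow> F x) (at 0)"
      by (simp add: DERIV_def)
    moreover have "filterlim (\<lambda>j. 1 / real (Suc j)) (at 0) sequentially"
      unfolding filterlim_at using lim_1_over_n[THEN LIMSEQ_Suc] by auto
    ultimately have "(\<lambda>j. (v (x + (1 / real (Suc j)) *\<^sub>R axis i 1) - v x) / (1 / real (Suc j))) \<longlonglongrightarrow> F x"
      by (rule filterlim_compose)
    then show ?thesis
      by (simp add: d_def e_def)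
  qed
  have "(\<lambda>x. g x \<bullet> axis i 1) \<in> borel_measurable lebesgue"
    by measurable
  then have [measurable]: "(\<lambda>x. g x $ i) \<in> borel_measurable lebesgue"
    by (simp add: inner_axis)
  have Fm: "F \<in> borel_measurable lebesgue"
    unfolding F_def by measurable
  have dm: "d j \<in> borel_measurable lebesgue" for j
    unfolding d_def by measurable
  have AEN: "AE x in lebesgue. x \<notin> N"
    using N AE_not_in negligible_iff_null_sets by blast
  have w: "integrable lebesgue (\<lambda>x::real^'n. C * indicator (cball 0 (M + 1)) x)"
    using lmeasurable_cball[of "0::real^'n" "M + 1"]
    by (intro integrable_mult_right) (auto simp: fmeasurable_def)
  have lim: "AE x in lebesgue. (\<lambda>j. d j x) \<longlonglongrightarrow> F x"
    using AEN by eventually_elim (rule dlim)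
  have Fint: "integrable lebesgue F"
    by (rule integrable_dominated_convergence[OF Fm dm w lim]) (use dbound in auto)
  have "(\<lambda>j. integral\<^sup>L lebesgue (d j)) \<longlonglongrightarrow> integral\<^sup>L lebesgue F"
    by (rule integral_dominated_convergence[OF Fm dm w lim]) (use dbound in auto)
  then have F0: "integral\<^sup>L lebesgue F = 0"
    by (simp add: dint LIMSEQ_const_iff)

  \<comment> \<open>Splitting the integral of \<open>F\<close> needs integrability of its summands.
    The one with \<open>u\<close> is bounded, \<open>u\<close> being continuous on \<open>K\<close>;
    the one with \<open>g\<close>, whose size is not controlled, follows by subtraction from
    \<open>F\<close>.\<close>
  have uint: "integrable lebesgue (\<lambda>x. u x * partial_deriv i \<phi> x)"
  proof -
    have "continuous_on K u"
    proof (rule continuous_at_imp_continuous_on, intro ballI)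
      fix x assume "x \<in> K"
      then obtain r L where r: "r > 0" "L-lipschitz_on (ball x r) u"
        using lip K \<open>D \<subseteq> \<Omega>\<close> by blast
      from lipschitz_on_continuous_on[OF r(2)] r(1) show "isCont u x"
        by (simp add: continuous_on_eq_continuous_at)
    qed
    then have "continuous_on K (\<lambda>x. u x * partial_deriv i \<phi> x)"
      using test_function_continuous_partial_deriv[OF \<phi>]
      by (intro continuous_on_mult) (auto intro: continuous_on_subset)
    then have "bounded ((\<lambda>x. u x * partial_deriv i \<phi> x) ` K)"
      using K(1) compact_continuous_image compact_imp_bounded by blast
    then obtain B where B: "\<And>x. x \<in> K \<Longrightarrow> \<bar>u x * partial_deriv i \<phi> x\<bar> \<le> B" and "B > 0"
      unfolding bounded_pos by auto
    then have "\<bar>u x * partial_deriv i \<phi> x\<bar> \<le> B * indicator (cball 0 M) x" for x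
      using M(2)[of x] B[of x] \<phi>'0[of x] by (cases "x \<in> K") auto
    then show ?thesis
      by (intro integrable_lebesgue_bounded_support[of _ B M]) auto
  qed
  have gint: "integrable lebesgue (\<lambda>x. g x $ i * \<phi> x)"
    using Bochner_Integration.integrable_diff[OF Fint uint] by (simp add: F_def)
  have sum0: "integral\<^sup>L lebesgue (\<lambda>x. u x * partial_deriv i \<phi> x) + integral\<^sup>L lebesgue (\<lambda>x. g x $ i * \<phi> x) = 0"
    using F0 Bochner_Integration.integral_add[OF gint uint] by (simp add: F_def)
  have restr: "integral\<^sup>L (lebesgue_on D) f = integral\<^sup>L lebesgue f" if "\<And>x. x \<notin> K \<Longrightarrow> f x = 0"
    for f :: "real^'n \<Rightarrow> real"
  proof -
    have "(\<lambda>x. indicator D x *\<^sub>R f x) = f"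
      using that K(2) by (auto simp: fun_eq_iff indicator_def)
    then show ?thesis
      using D by (simp add: integral_restrict_space del: real_scaleR_def)
  qed
  show "integral\<^sup>L (lebesgue_on D) (\<lambda>x. u x * partial_deriv i \<phi> x)
      = - integral\<^sup>L (lebesgue_on D) (\<lambda>x. g x $ i * \<phi> x)"
    using sum0 by (simp add: restr \<phi>0 \<phi>'0)
qed

section \<open>Functions supported in a single apartment\<close>

text \<open>The quantity \<open>h\<close>: half the width of a passage across axis \<open>m\<close>,
  but its whole length along that axis.\<close>

definition passage_width :: "real \<Rightarrow> real \<Rightarrow> real"
  where "passage_width \<beta> l = (l / 8) powr (1 / \<beta>)"

text \<open>By \<open>l \<le> 4\<close> the base is below 1, and the exponent is at least 1. The
  bound \<open>l / 8\<close> makes the opening fit into a face of the room and keeps the passage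
  inside the cube.\<close>

lemma passage_width_bounds:
  assumes "0 < l" "l \<le> 4" "0 < \<beta>" "\<beta> \<le> 1"
  shows "0 < passage_width \<beta> l" "passage_width \<beta> l \<le> l / 8"
proof -
  show "0 < passage_width \<beta> l"
    using assms by (simp add: passage_width_def)
  have "(l / 8) powr (1 / \<beta>) \<le> (l / 8) powr 1"
    using assms by (intro powr_mono') auto
  then show "passage_width \<beta> l \<le> l / 8"
    using assms by (simp add: passage_width_def)
qed

section \<open>Boxes and Whitney cubes\<close>

lemma cube_eq_cbox: "cube x l = cbox (\<chi> i. x $ i - l / 2) (\<chi> i. x $ i + l / 2)"
  by (auto simp: cube_def mem_box_cart)

lemma room_eq_box: "room x l = box (\<chi> i. x $ i - l / 8) (\<chi> i. x $ i + l / 8)"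
  by (auto simp: room_def mem_box_cart)

lemma passage_eq_box:
  "passage m \<beta> x l =
    box (\<chi> i. if i = m then x $ m + l / 8 else x $ i - passage_width \<beta> l)
        (\<chi> i. if i = m then x $ m + l / 8 + passage_width \<beta> l else x $ i + passage_width \<beta> l)"
  by (auto simp: passage_def mem_box_cart passage_width_def split: if_splits)

lemma long_passage_eq_box:
  "long_passage m \<beta> x l =
    box (\<chi> i. if i = m then x $ m else x $ i - passage_width \<beta> l)
        (\<chi> i. if i = m then x $ m + l / 2 else x $ i + passage_width \<beta> l)"
  by (auto simp: long_passage_def mem_box_cart passage_width_def split: if_splits)

lemma closure_room:
  assumes "0 < l"
  shows "closure (room x l) = cbox (\<chi> i. x $ i - l / 8) (\<chi> i. x $ i + l / 8)"
  unfolding room_eq_box using assms by (intro closure_box) (auto simp: interval_eq_empty_cart)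

lemma closure_passage:
  assumes "0 < passage_width \<beta> l"
  shows "closure (passage m \<beta> x l) =
    cbox (\<chi> i. if i = m then x $ m + l / 8 else x $ i - passage_width \<beta> l)
         (\<chi> i. if i = m then x $ m + l / 8 + passage_width \<beta> l else x $ i + passage_width \<beta> l)"
  unfolding passage_eq_box using assms by (intro closure_box) (auto simp: interval_eq_empty_cart)

lemma interior_cube: "interior (cube x l) = box (\<chi> i. x $ i - l / 2) (\<chi> i. x $ i + l / 2)"
  by (simp add: cube_eq_cbox)

text \<open>Lets the cubes of a fixed side be counted and summed over by their centres.\<close>

lemma cube_inject:
  fixes x x' :: "real^'n::finite"
  assumes "0 < l" "0 < l'" "cube x l = cube x' l'"
  shows "x = x'" "l = l'"
proof -
  have ne: "cube x l \<noteq> {}"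
    using assms(1) by (auto simp: cube_eq_cbox interval_eq_empty_cart)
  then have "(\<chi> i. x $ i - l / 2) = (\<chi> i. x' $ i - l' / 2)" "(\<chi> i. x $ i + l / 2) = (\<chi> i. x' $ i + l' / 2)"
    using assms(3) unfolding cube_eq_cbox eq_cbox by auto
  then have *: "x $ i - l / 2 = x' $ i - l' / 2 \<and> x $ i + l / 2 = x' $ i + l' / 2" for i
    by (simp add: vec_eq_iff)
  show "l = l'"
    \<comment> \<open>Any index would do; \<open>undefined\<close> names one.\<close>
    using *[of undefined] by linarith
  then show "x = x'"
    using * by (simp add: vec_eq_iff)
qed

text \<open>An open set that misses the interior of a cube misses the closure of that interior,
  which is the whole cube when \<open>0 < l'\<close>.\<close>

lemma whitney_cube_Int_interior:
  assumes "whitney G W" "cube x l \<in> W" "cube x' l' \<in> W" "cube x l \<noteq> cube x' l'" "0 < l'"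
  shows "interior (cube x l) \<inter> cube x' l' = {}"
proof -
  have "interior (cube x l) \<inter> interior (cube x' l') = {}"
    using assms unfolding whitney_def pairwise_def by blast
  moreover have "closure (interior (cube x' l')) = cube x' l'"
    unfolding interior_cube unfolding cube_eq_cbox using assms(5)
    by (intro closure_box) (auto simp: interval_eq_empty_cart)
  ultimately show ?thesis
    using open_Int_closure_eq_empty[OF open_interior] by metis
qed

text \<open>The centres of two opposite faces lie in \<open>G\<close> at distance \<open>l\<close>.
  With \<open>diameter G \<le> 4\<close> this supplies the bound \<open>l \<le> 4\<close> on which
  the geometry of an apartment rests.\<close>

lemma whitney_cube_side_le_diameter:
  fixes x :: "real^'n::finite"
  assumes "whitney G W" "bounded G" "cube x l \<in> W" "0 < l"
  shows "l \<le> diameter G"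
proof -
  fix i :: 'n
  define y where "y = x + (l / 2) *\<^sub>R axis i 1"
  define z where "z = x - (l / 2) *\<^sub>R axis i 1"
  have "y \<in> cube x l" "z \<in> cube x l"
    using assms(4) by (auto simp: cube_def y_def z_def axis_def)
  then have "dist y z \<le> diameter G"
    using assms(1-3) by (intro diameter_bounded_bound) (auto simp: whitney_def)
  moreover have "y - z = l *\<^sub>R axis i 1"
    by (simp add: y_def z_def scaleR_left_distrib[symmetric])
  ultimately show ?thesis
    using assms(4) by (simp add: dist_norm norm_axis_1)
qed

text \<open>The long passage also covers the openings at both ends of the passage, which the room
  and the passage, being open, do not contain.\<close>

definition chamber :: "'n \<Rightarrow> real \<Rightarrow> real^'n::finite \<Rightarrow> real \<Rightarrow> (real^'n) set"
  where "chamber m \<beta> x l = room x l \<union> long_passage m \<beta> x l"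

definition exterior :: "'n \<Rightarrow> real \<Rightarrow> real^'n::finite \<Rightarrow> real \<Rightarrow> (real^'n) set"
  where "exterior m \<beta> x l = - (closure (room x l) \<union> closure (passage m \<beta> x l))"

text \<open>The chamber and the exterior are open, they cover the \<open>\<beta>\<close>-version, and the function below is
  Lipschitz on each of them; the walls where it jumps belong to neither.\<close>

definition ramp :: "'n \<Rightarrow> real \<Rightarrow> real^'n::finite \<Rightarrow> real \<Rightarrow> real^'n \<Rightarrow> real"
  where "ramp m \<beta> x l y =
    max 0 (min 1 ((x $ m + l / 8 + passage_width \<beta> l - y $ m) / passage_width \<beta> l))"

definition chamber_fun :: "'n \<Rightarrow> real \<Rightarrow> real^'n::finite \<Rightarrow> real \<Rightarrow> real^'n \<Rightarrow> real"
  where "chamber_fun m \<beta> x l y = (if y \<in> chamber m \<beta> x l then ramp m \<beta> x l y else 0)"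

definition chamber_grad :: "'n \<Rightarrow> real \<Rightarrow> real^'n::finite \<Rightarrow> real \<Rightarrow> real^'n \<Rightarrow> real^'n"
  where "chamber_grad m \<beta> x l y =
    (- indicator (passage m \<beta> x l) y / passage_width \<beta> l) *\<^sub>R axis m 1"

lemma open_chamber: "open (chamber m \<beta> x l)"
  by (auto simp: chamber_def room_eq_box long_passage_eq_box)

lemma open_exterior: "open (exterior m \<beta> x l)"
  by (auto simp: exterior_def)

section \<open>Geometry of one apartment and regularity of its function\<close>

context
  fixes m :: "'n::finite" and \<beta> l :: real and x :: "real^'n"
  assumes l: "0 < l" "l \<le> 4" and \<beta>: "0 < \<beta>" "\<beta> \<le> 1"
begin

lemma chamber_subset_interior_cube: "chamber m \<beta> x l \<subseteq> interior (cube x l)"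
proof
  fix y assume "y \<in> chamber m \<beta> x l"
  then consider "y \<in> room x l" | "y \<in> long_passage m \<beta> x l"
    by (auto simp: chamber_def)
  then have "x $ i - l / 2 < y $ i \<and> y $ i < x $ i + l / 2" for i
  proof cases
    case 1
    then have "x $ i - l / 8 < y $ i \<and> y $ i < x $ i + l / 8"
      by (simp add: room_def)
    then show ?thesis
      using l by linarith
  next
    case 2
    then show ?thesis
      using l passage_width_bounds[OF l \<beta>]
      by (cases "i = m") (force simp: long_passage_def passage_width_def)+
  qed
  then show "y \<in> interior (cube x l)"
    by (simp add: interior_cube mem_box_cart)
qed

text \<open>Both closures lie strictly inside the cube. Hence the points of any other Whitney cube
  are exterior to this room and passage.\<close>

lemma exterior_Un_interior_cube: "exterior m \<beta> x l \<union> interior (cube x l) = UNIV"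
proof -
  have "y \<in> interior (cube x l)" if "y \<in> closure (room x l) \<union> closure (passage m \<beta> x l)" for y
  proof -
    have "x $ i - l / 2 < y $ i \<and> y $ i < x $ i + l / 2" for i
      using that
    proof
      assume "y \<in> closure (room x l)"
      then have "x $ i - l / 8 \<le> y $ i \<and> y $ i \<le> x $ i + l / 8"
        using l by (simp add: closure_room mem_box_cart)
      then show ?thesis
        using l by linarith
    next
      assume "y \<in> closure (passage m \<beta> x l)"
      then have "(if i = m then x $ m + l / 8 else x $ i - passage_width \<beta> l) \<le> y $ i"
        "y $ i \<le> (if i = m then x $ m + l / 8 + passage_width \<beta> l else x $ i + passage_width \<beta> l)"
        using passage_width_bounds[OF l \<beta>] by (auto simp: closure_passage mem_box_cart)
      then show ?thesis
        using l passage_width_bounds[OF l \<beta>] by (auto split: if_splits)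
    qed
    then show ?thesis
      by (simp add: interior_cube mem_box_cart)
  qed
  then show ?thesis
    by (auto simp: exterior_def)
qed

lemma passage_subset_chamber: "passage m \<beta> x l \<subseteq> chamber m \<beta> x l"
  using l passage_width_bounds[OF l \<beta>]
  by (force simp: passage_def chamber_def long_passage_def passage_width_def)

text \<open>Removal of the walls is used here: a point of the cube outside the chamber is in neither
  open set, and off both frontiers it is in neither closure.\<close>

lemma apartment_subset_chamber_Un_exterior:
  "apartment m \<beta> x l \<subseteq> chamber m \<beta> x l \<union> exterior m \<beta> x l"
  using passage_subset_chamber
  by (auto simp: apartment_def chamber_def exterior_def closure_Un_frontier)

text \<open>The two open sets can overlap only beyond the far end of the passage, where the ramp has
  dropped to 0; so the function is 0 on the whole exterior.\<close>

lemma chamber_Int_exterior: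
  assumes y: "y \<in> chamber m \<beta> x l" "y \<in> exterior m \<beta> x l"
  shows "x $ m + l / 8 + passage_width \<beta> l < y $ m"
proof (rule ccontr)
  note h = passage_width_bounds[OF l \<beta>]
  assume "\<not> ?thesis"
  then have le: "y $ m \<le> x $ m + l / 8 + passage_width \<beta> l"
    by simp
  have "y \<notin> room x l"
    using y(2) closure_subset by (auto simp: exterior_def)
  then have L: "y \<in> long_passage m \<beta> x l"
    using y(1) by (simp add: chamber_def)
  then have *: "x $ i - passage_width \<beta> l \<le> y $ i \<and> y $ i \<le> x $ i + passage_width \<beta> l" if "i \<noteq> m" for i
    using that by (auto simp: long_passage_def passage_width_def less_imp_le)
  have **: "x $ m < y $ m"
    using L by (simp add: long_passage_def)
  show False
  \<comment> \<open>Up to the level of the opening,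
    \<open>passage_width \<beta> l \<le> l / 8\<close> puts the point into the closed room; above
    it, the point is in the closed passage.\<close>
  proof (cases "y $ m \<le> x $ m + l / 8")
    case True
    have "x $ i - l / 8 \<le> y $ i \<and> y $ i \<le> x $ i + l / 8" for i
      using True *[of i] ** h l by (cases "i = m") auto
    then have "y \<in> closure (room x l)"
      using l by (simp add: closure_room mem_box_cart)
    then show False
      using y(2) by (simp add: exterior_def)
  next
    case False
    then have "y \<in> closure (passage m \<beta> x l)"
      using h le * by (auto simp: closure_passage mem_box_cart)
    then show False
      using y(2) by (simp add: exterior_def)
  qed
qed

lemma chamber_fun_exterior: "y \<in> exterior m \<beta> x l \<Longrightarrow> chamber_fun m \<beta> x l y = 0"
  using chamber_Int_exterior[of y] passage_width_bounds[OF l \<beta>]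
  by (auto simp: chamber_fun_def ramp_def divide_nonpos_pos)

lemma chamber_fun_room:
  assumes "y \<in> room x l"
  shows "chamber_fun m \<beta> x l y = 1"
proof -
  have "y $ m < x $ m + l / 8"
    using assms by (simp add: room_def)
  then show ?thesis
    using assms passage_width_bounds[OF l \<beta>] by (simp add: chamber_fun_def ramp_def chamber_def)
qed

lemma lipschitz_ramp: "(1 / passage_width \<beta> l)-lipschitz_on X (ramp m \<beta> x l)"
proof (rule lipschitz_onI)
  note h = passage_width_bounds[OF l \<beta>]
  fix y z :: "real^'n"
  define a where "a = (\<lambda>y::real^'n. (x $ m + l / 8 + passage_width \<beta> l - y $ m) / passage_width \<beta> l)"
  have ramp_eq: "ramp m \<beta> x l y = max 0 (min 1 (a y))" for y
    by (simp add: ramp_def a_def)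
  have "dist (ramp m \<beta> x l y) (ramp m \<beta> x l z) \<le> \<bar>a y - a z\<bar>"
    unfolding ramp_eq dist_real_def by linarith
  also have "\<dots> = \<bar>(y - z) $ m\<bar> / passage_width \<beta> l"
    using h by (simp add: a_def diff_divide_distrib[symmetric] abs_divide abs_minus_commute)
  also have "\<dots> \<le> norm (y - z) / passage_width \<beta> l"
    using h by (intro divide_right_mono component_le_norm_cart) auto
  finally show "dist (ramp m \<beta> x l y) (ramp m \<beta> x l z) \<le> 1 / passage_width \<beta> l * dist y z"
    by (simp add: dist_norm)
qed (use passage_width_bounds[OF l \<beta>] in simp)

lemma chamber_fun_locally_lipschitz:
  assumes "y \<in> chamber m \<beta> x l \<union> exterior m \<beta> x l"
  shows "\<exists>r>0. \<exists>L. L-lipschitz_on (ball y r) (chamber_fun m \<beta> x l)"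
  using assms
proof
  assume "y \<in> chamber m \<beta> x l"
  then obtain r where r: "r > 0" "ball y r \<subseteq> chamber m \<beta> x l"
    using open_chamber open_contains_ball by blast
  have "(1 / passage_width \<beta> l)-lipschitz_on (ball y r) (chamber_fun m \<beta> x l)"
    by (rule lipschitz_on_transform[OF lipschitz_ramp]) (use r in \<open>auto simp: chamber_fun_def subset_iff\<close>)
  with r(1) show ?thesis
    by blast
next
  assume "y \<in> exterior m \<beta> x l"
  then obtain r where r: "r > 0" "ball y r \<subseteq> exterior m \<beta> x l"
    using open_exterior open_contains_ball by blast
  have "0-lipschitz_on (ball y r) (chamber_fun m \<beta> x l)"
    by (rule lipschitz_on_transform[OF lipschitz_on_constant[of _ 0]])
      (use r chamber_fun_exterior in \<open>auto simp: subset_iff\<close>)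
  with r(1) show ?thesis
    by blast
qed

text \<open>The two excluded levels are those where the ramp bends. Every other point has a
  neighbourhood on which the function is constant or affine.\<close>

lemma chamber_fun_has_derivative:
  assumes y: "y \<in> chamber m \<beta> x l \<union> exterior m \<beta> x l"
    and ne: "y $ m \<noteq> x $ m + l / 8" "y $ m \<noteq> x $ m + l / 8 + passage_width \<beta> l"
  shows "(chamber_fun m \<beta> x l has_derivative (\<lambda>d. chamber_grad m \<beta> x l y \<bullet> d)) (at y)"
proof -
  note h = passage_width_bounds[OF l \<beta>]
  have op: "open {z::real^'n. z $ m < a}" "open {z::real^'n. a < z $ m}" for a
    by (auto intro!: open_Collect_less continuous_intros)
  consider (out) "y \<in> exterior m \<beta> x l" | (low) "y \<in> chamber m \<beta> x l" "y $ m < x $ m + l / 8"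
    | (mid) "y \<in> chamber m \<beta> x l" "x $ m + l / 8 < y $ m" "y $ m < x $ m + l / 8 + passage_width \<beta> l"
    | (high) "y \<in> chamber m \<beta> x l" "x $ m + l / 8 + passage_width \<beta> l < y $ m"
    using y ne by fastforce
  then show ?thesis
  proof cases
    case out
    then have "y \<notin> passage m \<beta> x l"
      using closure_subset by (auto simp: exterior_def)
    then have g: "chamber_grad m \<beta> x l y = 0"
      by (simp add: chamber_grad_def)
    have "((\<lambda>_. 0) has_derivative (\<lambda>_. 0)) (at y)"
      by simp
    then have "(chamber_fun m \<beta> x l has_derivative (\<lambda>_. 0)) (at y)"
      by (rule has_derivative_transform_within_open[OF _ open_exterior out]) (simp add: chamber_fun_exterior)
    then show ?thesis
      by (simp add: g)
  next
    case low
    then have g: "chamber_grad m \<beta> x l y = 0"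
      by (simp add: chamber_grad_def passage_def)
    have "((\<lambda>_. 1) has_derivative (\<lambda>_. 0)) (at y)"
      by simp
    then have "(chamber_fun m \<beta> x l has_derivative (\<lambda>_. 0)) (at y)"
      by (rule has_derivative_transform_within_open[OF _ open_Int[OF open_chamber op(1)[of "x $ m + l / 8"]]])
        (use low h in \<open>auto simp: chamber_fun_def ramp_def\<close>)
    then show ?thesis
      by (simp add: g)
  next
    case mid
    \<comment> \<open>A chamber point above the room lies in the long passage, which between the two
      levels coincides with the passage; so the indicator in the gradient is 1.\<close>
    have "y \<notin> room x l"
      using mid by (auto simp: room_def intro!: exI[of _ m])
    then have "y \<in> long_passage m \<beta> x l"
      using mid by (simp add: chamber_def)
    then have "y \<in> passage m \<beta> x l"
      using mid by (auto simp: long_passage_def passage_def passage_width_def)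
    then have g: "(\<lambda>d. chamber_grad m \<beta> x l y \<bullet> d) = (\<lambda>d. - d $ m / passage_width \<beta> l)"
      by (simp add: chamber_grad_def fun_eq_iff inner_commute[of "axis m 1"] inner_axis)
    have "((\<lambda>z. (x $ m + l / 8 + passage_width \<beta> l - z $ m) / passage_width \<beta> l) has_derivative (\<lambda>d. - d $ m / passage_width \<beta> l)) (at y)"
      using h by (auto intro!: derivative_eq_intros bounded_linear_imp_has_derivative bounded_linear_vec_nth)
    then have "(chamber_fun m \<beta> x l has_derivative (\<lambda>d. - d $ m / passage_width \<beta> l)) (at y)"
      by (rule has_derivative_transform_within_open[OF _ open_Int[OF open_chamber
              open_Int[OF op(2)[of "x $ m + l / 8"] op(1)[of "x $ m + l / 8 + passage_width \<beta> l"]]]])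
        (use mid h in \<open>auto simp: chamber_fun_def ramp_def\<close>)
    then show ?thesis
      by (simp add: g)
  next
    case high
    then have g: "chamber_grad m \<beta> x l y = 0"
      by (simp add: chamber_grad_def passage_def passage_width_def)
    have "((\<lambda>_. 0) has_derivative (\<lambda>_. 0)) (at y)"
      by simp
    then have "(chamber_fun m \<beta> x l has_derivative (\<lambda>_. 0)) (at y)"
      by (rule has_derivative_transform_within_open[OF _ open_Int[OF open_chamber op(2)[of "x $ m + l / 8 + passage_width \<beta> l"]]])
        (use high h in \<open>auto simp: chamber_fun_def ramp_def divide_nonpos_pos\<close>)
    then show ?thesis
      by (simp add: g)
  qed
qed

end

lemma chamber_fun_bounds: "0 \<le> chamber_fun m \<beta> x l y" "chamber_fun m \<beta> x l y \<le> 1"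
  by (auto simp: chamber_fun_def ramp_def)

section \<open>Test functions for a layer of Whitney cubes\<close>

lemma locally_lipschitz_sum:
  fixes f :: "'i \<Rightarrow> 'a::metric_space \<Rightarrow> real"
  assumes "finite I" "\<And>i. i \<in> I \<Longrightarrow> \<exists>r>0. \<exists>L. L-lipschitz_on (ball y r) (f i)"
  shows "\<exists>r>0. \<exists>L. L-lipschitz_on (ball y r) (\<lambda>z. \<Sum>i\<in>I. f i z)"
  using assms
proof (induction I rule: finite_induct)
  case empty
  show ?case
    using lipschitz_on_constant[of "ball y 1" "0::real"] by (auto intro: zero_less_one)
next
  case (insert i I)
  obtain r L where r: "r > 0" "L-lipschitz_on (ball y r) (f i)"
    using insert.prems[of i] by auto
  obtain r' L' where r': "r' > 0" "L'-lipschitz_on (ball y r') (\<lambda>z. \<Sum>i\<in>I. f i z)"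
    using insert.IH insert.prems by auto
  have "(L + L')-lipschitz_on (ball y (min r r')) (\<lambda>z. f i z + (\<Sum>i\<in>I. f i z))"
    by (intro lipschitz_on_add lipschitz_on_subset[OF r(2)] lipschitz_on_subset[OF r'(2)]) auto
  then show ?case
    using r(1) r'(1) insert.hyps by (intro exI[of _ "min r r'"]) auto
qed

section \<open>Volumes, measurability and the position of rooms and corners\<close>

lemma measure_box_equal_sides:
  fixes a :: "real^'n::finite"
  assumes "0 \<le> c"
  shows "measure lebesgue (box a (\<chi> i. a $ i + c)) = c ^ CARD('n)"
proof -
  have "((\<chi> i. a $ i + c) - a) \<bullet> b = c" if "b \<in> Basis" for b
    using that by (auto simp: Basis_vec_def inner_axis)
  moreover have "a \<bullet> b \<le> (\<chi> i. a $ i + c) \<bullet> b" if "b \<in> Basis" for b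
    using that assms by (auto simp: Basis_vec_def inner_axis)
  ultimately show ?thesis
    by (simp add: measure_completion)
qed

lemma beta_version_subset:
  assumes "whitney G W" "bounded G" "diameter G \<le> 4" "0 < \<beta>" "\<beta> \<le> 1"
  shows "beta_version m \<beta> W \<subseteq> G"
proof -
  have "apartment m \<beta> x l \<subseteq> G" if "0 < l" "cube x l \<in> W" for x l
  proof -
    have l: "l \<le> 4"
      using whitney_cube_side_le_diameter[OF assms(1,2) that(2,1)] assms(3) by linarith
    have "apartment m \<beta> x l \<subseteq> cube x l"
      using chamber_subset_interior_cube[OF that(1) l assms(4,5), of m x] interior_subset[of "cube x l"]
      by (auto simp: apartment_def chamber_def)
    then show ?thesis
      using assms(1) that(2) unfolding whitney_def by blast
  qed
  then show ?thesis
    by (auto simp: beta_version_def)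
qed

text \<open>Apartments are Borel sets but contain boundary points of closed cubes. Rather than
  openness of the union, countability of the dyadic cubes is used, each of which determines its
  centre and side.\<close>

lemma beta_version_borel:
  assumes "whitney G W"
  shows "beta_version m \<beta> W \<in> sets borel"
proof -
  have "W \<subseteq> range (\<lambda>(j::int, z::int^'a).
      {y. \<forall>i. 2 powi j * of_int (z $ i) \<le> y $ i \<and> y $ i \<le> 2 powi j * (of_int (z $ i) + 1)})"
    using assms unfolding whitney_def dyadic_cube_def by fastforce
  then have "countable W"
    by (rule countable_subset) simp
  define J where "J = {(x, l). 0 < l \<and> cube x l \<in> W}"
  have "inj_on (\<lambda>(x, l). cube x l) J"
    unfolding inj_on_def J_def using cube_inject by fast
  moreover have "countable ((\<lambda>(x, l). cube x l) ` J)"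
    by (rule countable_subset[OF _ \<open>countable W\<close>]) (auto simp: J_def)
  ultimately have "countable J"
    using countable_image_inj_on by blast
  have "apartment m \<beta> x l \<in> sets borel" for x l
    by (auto simp: apartment_def long_passage_eq_box cube_eq_cbox borel_closed)
  then have "(\<Union>(x, l)\<in>J. apartment m \<beta> x l) \<in> sets borel"
    using \<open>countable J\<close> by (intro sets.countable_UN') auto
  moreover have "beta_version m \<beta> W = (\<Union>(x, l)\<in>J. apartment m \<beta> x l)"
    by (auto simp: beta_version_def J_def)
  ultimately show ?thesis
    by simp
qed

text \<open>A translate of the room, hence of equal volume, on which the function vanishes. It takes
  the place of the room when the average exceeds 1/2.\<close>

definition corner :: "real^'n::finite \<Rightarrow> real \<Rightarrow> (real^'n) set"
  where "corner x l = box (\<chi> i. x $ i - l / 2) (\<chi> i. x $ i - l / 4)"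

lemma measure_room: "0 < l \<Longrightarrow> measure lebesgue (room (x::real^'n::finite) l) = (l / 4) ^ CARD('n)"
  using measure_box_equal_sides[of "l / 4" "\<chi> i. x $ i - l / 8"] by (simp add: room_eq_box add.commute)

lemma measure_corner: "0 < l \<Longrightarrow> measure lebesgue (corner (x::real^'n::finite) l) = (l / 4) ^ CARD('n)"
  using measure_box_equal_sides[of "l / 4" "\<chi> i. x $ i - l / 2"] by (simp add: corner_def)

text \<open>Doubling the passage along axis \<open>m\<close> makes it a cube of side
  \<open>2 * passage_width \<beta> l\<close>; the factor lost is harmless.\<close>

lemma measure_passage_le:
  fixes x :: "real^'n::finite"
  assumes "0 < passage_width \<beta> l"
  shows "measure lebesgue (passage m \<beta> x l) \<le> (2 * passage_width \<beta> l) ^ CARD('n)"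
proof -
  define a where "a = (\<chi> i. if i = m then x $ m + l / 8 else x $ i - passage_width \<beta> l)"
  have "passage m \<beta> x l \<subseteq> box a (\<chi> i. a $ i + 2 * passage_width \<beta> l)"
    using assms by (auto simp: passage_def passage_width_def[symmetric] a_def mem_box_cart add.commute)
  then have "measure lebesgue (passage m \<beta> x l) \<le> measure lebesgue (box a (\<chi> i. a $ i + 2 * passage_width \<beta> l))"
    by (intro measure_mono_fmeasurable) (auto simp: passage_eq_box)
  then show ?thesis
    using assms measure_box_equal_sides[of "2 * passage_width \<beta> l" a] by simp
qed

lemma corner_subset:
  assumes "0 < l"
  shows "corner x l \<subseteq> exterior m \<beta> x l \<inter> interior (cube x l)"
proof
  fix y assume "y \<in> corner x l"
  then have y: "x $ i - l / 2 < y $ i \<and> y $ i < x $ i - l / 4" for i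
    by (simp add: corner_def mem_box_cart)
  \<comment> \<open>Coordinate \<open>m\<close> alone separates: the corner stays below the level
    that bounds the room and the passage from below.\<close>
  have sub: "closure (room x l) \<union> closure (passage m \<beta> x l) \<subseteq> {z. x $ m - l / 8 \<le> z $ m}"
    unfolding closure_Un[symmetric] using assms
    by (intro closure_minimal) (auto simp: room_def passage_def intro: less_imp_le closed_halfspace_component_ge_cart)
  have "y \<in> exterior m \<beta> x l"
    using subsetD[OF sub, of y] y[of m] assms by (auto simp: exterior_def)
  moreover have "x $ i - l / 2 < y $ i \<and> y $ i < x $ i + l / 2" for i
    using y[of i] assms by linarith
  ultimately show "y \<in> exterior m \<beta> x l \<inter> interior (cube x l)"
    by (simp add: interior_cube mem_box_cart)
qed

lemma room_subset_apartment:
  assumes "0 < l"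
  shows "room x l \<subseteq> apartment m \<beta> x l"
proof
  fix y assume y: "y \<in> room x l"
  then have *: "x $ i - l / 8 < y $ i \<and> y $ i < x $ i + l / 8" for i
    by (simp add: room_def)
  have "x $ i - l / 2 \<le> y $ i \<and> y $ i \<le> x $ i + l / 2" for i
    using *[of i] assms by linarith
  then have "y \<in> cube x l"
    by (simp add: cube_def)
  moreover have "y \<notin> frontier (room x l)"
    using y frontier_disjoint_eq[of "room x l"] by (auto simp: room_eq_box)
  \<comment> \<open>The closed passage starts at the level of the top face of the room, which the
    open room does not reach.\<close>
  moreover have "closure (passage m \<beta> x l) \<subseteq> {z. x $ m + l / 8 \<le> z $ m}"
    by (intro closure_minimal) (auto simp: passage_def intro: closed_halfspace_component_ge_cart)
  then have "y \<notin> frontier (passage m \<beta> x l)"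
    using *[of m] by (auto simp: frontier_def)
  ultimately show "y \<in> apartment m \<beta> x l"
    by (simp add: apartment_def)
qed

lemma cube_Int_exterior_subset_apartment: "cube x l \<inter> exterior m \<beta> x l \<subseteq> apartment m \<beta> x l"
  by (auto simp: apartment_def exterior_def closure_Un_frontier)

text \<open>The sum runs over centres in place of cubes. An infinite index set would make it 0 by
  default, hence the finiteness assumption \<open>fin\<close> below.\<close>

definition layer_fun :: "'n \<Rightarrow> real \<Rightarrow> (real^'n::finite) set set \<Rightarrow> real \<Rightarrow> real^'n \<Rightarrow> real"
  where "layer_fun m \<beta> W l y = (\<Sum>x | cube x l \<in> W. chamber_fun m \<beta> x l y)"

definition layer_grad :: "'n \<Rightarrow> real \<Rightarrow> (real^'n::finite) set set \<Rightarrow> real \<Rightarrow> real^'n \<Rightarrow> real^'n"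
  where "layer_grad m \<beta> W l y = (\<Sum>x | cube x l \<in> W. chamber_grad m \<beta> x l y)"

section \<open>Norm estimates for a finite layer of cubes of side \<open>l\<close>\<close>

context
  fixes m :: "'n::finite" and \<beta> l :: real and G :: "(real^'n) set" and W :: "(real^'n) set set"
  assumes W: "whitney G W" and G: "bounded G" "diameter G \<le> 4"
    and l: "0 < l" and \<beta>: "0 < \<beta>" "\<beta> \<le> 1"
    and fin: "finite {x. cube x l \<in> W}"
begin

lemma layer_interiors_disjoint: "disjoint_family_on (\<lambda>x. interior (cube x l)) {x. cube x l \<in> W}"
proof -
  have "interior (cube x l) \<inter> interior (cube x' l) = {}" if "cube x l \<in> W" "cube x' l \<in> W" "x \<noteq> x'" for x x'
    using whitney_cube_Int_interior[OF W that(1,2) _ l] cube_inject(1)[OF l l] that(3) interior_subset by blast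
  then show ?thesis
    by (simp add: disjoint_family_on_def)
qed

lemma layer_side_le_4: "cube x l \<in> W \<Longrightarrow> l \<le> 4"
  using whitney_cube_side_le_diameter[OF W G(1) _ l] G(2) by fastforce

text \<open>A point of the same cube falls under the result for one apartment; a point of a
  different cube misses the interior of this one. So each summand of \<open>layer_fun\<close> is
  locally Lipschitz at all points of the \<beta>-version.\<close>

lemma beta_version_subset_chamber_Un_exterior:
  assumes Q: "cube x l \<in> W"
  shows "beta_version m \<beta> W \<subseteq> chamber m \<beta> x l \<union> exterior m \<beta> x l"
proof
  fix y assume y: "y \<in> beta_version m \<beta> W"
  then obtain x' l' where *: "0 < l'" "cube x' l' \<in> W" "y \<in> apartment m \<beta> x' l'"
    by (auto simp: beta_version_def)
  note l4 = layer_side_le_4[OF Q]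
  show "y \<in> chamber m \<beta> x l \<union> exterior m \<beta> x l"
  proof (cases "cube x l = cube x' l'")
    case True
    then have "x' = x" "l' = l"
      using cube_inject[OF l *(1) True] by auto
    then show ?thesis
      using * apartment_subset_chamber_Un_exterior[OF l l4 \<beta>] by blast
  next
    case False
    have l': "l' \<le> 4"
      using whitney_cube_side_le_diameter[OF W G(1) *(2,1)] G(2) by linarith
    have "y \<in> cube x' l'"
      using * chamber_subset_interior_cube[OF *(1) l' \<beta>, of m x'] interior_subset[of "cube x' l'"]
      by (auto simp: apartment_def chamber_def)
    then have "y \<notin> interior (cube x l)"
      using whitney_cube_Int_interior[OF W Q *(2) False *(1)] by blast
    then show ?thesis
      using exterior_Un_interior_cube[OF l l4 \<beta>] by blast
  qed
qed

lemma layer_fun_eq_chamber_fun: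
  assumes Q: "cube x l \<in> W" and y: "y \<in> interior (cube x l)"
  shows "layer_fun m \<beta> W l y = chamber_fun m \<beta> x l y"
proof -
  have "chamber_fun m \<beta> x' l y = 0" if "cube x' l \<in> W" "x' \<noteq> x" for x'
  proof -
    have "y \<notin> interior (cube x' l)"
      using layer_interiors_disjoint that Q y by (auto simp: disjoint_family_on_def)
    then show ?thesis
      using chamber_subset_interior_cube[OF l layer_side_le_4[OF Q] \<beta>] by (auto simp: chamber_fun_def)
  qed
  then have "layer_fun m \<beta> W l y = (\<Sum>x'\<in>{x}. chamber_fun m \<beta> x' l y)"
    unfolding layer_fun_def using fin Q by (intro sum.mono_neutral_right) auto
  then show ?thesis
    by simp
qed

lemma chamber_fun_borel_measurable: "chamber_fun m \<beta> x l \<in> borel_measurable borel"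
proof -
  have "continuous_on UNIV (\<lambda>y::real^'n. (x $ m + l / 8 + passage_width \<beta> l - y $ m) / passage_width \<beta> l)"
    using l \<beta> by (intro continuous_intros) (simp add: passage_width_def)
  then have "ramp m \<beta> x l \<in> borel_measurable borel"
    unfolding ramp_def[abs_def]
    by (intro borel_measurable_max borel_measurable_min borel_measurable_const borel_measurable_continuous_onI)
  moreover have "chamber m \<beta> x l \<in> sets borel"
    by (simp add: borel_open open_chamber)
  ultimately show ?thesis
    unfolding chamber_fun_def[abs_def] by (intro measurable_If_set) auto
qed

lemma layer_fun_measurable: "layer_fun m \<beta> W l \<in> borel_measurable lebesgue"
  unfolding layer_fun_def[abs_def]
  by (intro measurable_completion) (simp add: borel_measurable_sum chamber_fun_borel_measurable)

text \<open>Passages in disjoint interiors are disjoint, so their indicators add up to the indicator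
  of the union; norm and measurability are read off from this form.\<close>

lemma layer_grad_eq:
  "layer_grad m \<beta> W l y =
    (- indicator (\<Union>x\<in>{x. cube x l \<in> W}. passage m \<beta> x l) y / passage_width \<beta> l) *\<^sub>R axis m 1"
proof -
  have "passage m \<beta> x l \<subseteq> interior (cube x l)" if "cube x l \<in> W" for x
    using passage_subset_chamber[OF l layer_side_le_4[OF that] \<beta>] chamber_subset_interior_cube[OF l layer_side_le_4[OF that] \<beta>]
    by blast
  then have "disjoint_family_on (\<lambda>x. passage m \<beta> x l) {x. cube x l \<in> W}"
    using layer_interiors_disjoint unfolding disjoint_family_on_def by blast
  then have "indicator (\<Union>x\<in>{x. cube x l \<in> W}. passage m \<beta> x l) y =
      (\<Sum>x | cube x l \<in> W. indicator (passage m \<beta> x l) y :: real)"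
    using fin by (intro indicator_UN_disjoint)
  then show ?thesis
    by (simp only: layer_grad_def chamber_grad_def scaleR_left.sum[symmetric] sum_divide_distrib[symmetric]
        sum_negf)
qed

lemma layer_grad_measurable: "layer_grad m \<beta> W l \<in> borel_measurable lebesgue"
proof -
  have "(\<Union>x\<in>{x. cube x l \<in> W}. passage m \<beta> x l) \<in> sets borel"
    by (intro borel_open open_UN) (auto simp: passage_eq_box)
  then show ?thesis
    unfolding layer_grad_eq[abs_def] by (intro measurable_completion) simp
qed

lemma weak_gradient_layer_fun:
  "weak_gradient (beta_version m \<beta> W) (layer_fun m \<beta> W l) (layer_grad m \<beta> W l)"
proof (rule weak_gradient_locally_lipschitz)
  \<comment> \<open>At points of \<open>\<Omega>\<close> all summands are locally Lipschitz;
    \<open>N\<close> is a finite union of hyperplanes at which some ramp bends.\<close>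
  define \<Omega> where "\<Omega> = {y. \<forall>x. cube x l \<in> W \<longrightarrow> y \<in> chamber m \<beta> x l \<union> exterior m \<beta> x l}"
  define N where "N = (\<Union>x\<in>{x. cube x l \<in> W}.
    {y::real^'n. y $ m = x $ m + l / 8} \<union> {y. y $ m = x $ m + l / 8 + passage_width \<beta> l})"
  show "beta_version m \<beta> W \<subseteq> \<Omega>"
    unfolding \<Omega>_def using beta_version_subset_chamber_Un_exterior by blast
  show "beta_version m \<beta> W \<in> sets lebesgue"
    using beta_version_borel[OF W] by (simp add: sets_completionI_sets)
  have "negligible {y::real^'n. y $ m = c}" for c
    using negligible_standard_hyperplane[of "axis m 1 :: real^'n" c] by (simp add: inner_axis)
  then show "negligible N"
    unfolding N_def using fin by (auto intro!: negligible_Union negligible_Un)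
  show "\<exists>r>0. \<exists>L. L-lipschitz_on (ball y r) (layer_fun m \<beta> W l)" if "y \<in> \<Omega>" for y
    unfolding layer_fun_def[abs_def]
  proof (rule locally_lipschitz_sum[OF fin])
    fix x assume "x \<in> {x. cube x l \<in> W}"
    with that show "\<exists>r>0. \<exists>L. L-lipschitz_on (ball y r) (chamber_fun m \<beta> x l)"
      by (intro chamber_fun_locally_lipschitz[OF l layer_side_le_4 \<beta>]) (auto simp: \<Omega>_def)
  qed
  show "(layer_fun m \<beta> W l has_derivative (\<lambda>h. layer_grad m \<beta> W l y \<bullet> h)) (at y)" if "y \<in> \<Omega> - N" for y
    unfolding layer_fun_def[abs_def] layer_grad_def inner_sum_left
    using that
    by (intro has_derivative_sum chamber_fun_has_derivative[OF l layer_side_le_4 \<beta>]) (auto simp: \<Omega>_def N_def)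
qed (rule layer_fun_measurable layer_grad_measurable)+

lemma beta_version_lmeasurable: "beta_version m \<beta> W \<in> lmeasurable"
  using bounded_subset[OF G(1) beta_version_subset[OF W G \<beta>]] beta_version_borel[OF W]
  by (intro bounded_set_imp_lmeasurable) (auto simp: sets_completionI_sets)

lemma norm_layer_grad:
  "norm (layer_grad m \<beta> W l y) =
    indicator (\<Union>x\<in>{x. cube x l \<in> W}. passage m \<beta> x l) y / passage_width \<beta> l"
  using l by (simp add: layer_grad_eq norm_axis_1 passage_width_def)

lemma sobolev_layer_fun:
  assumes "0 < p"
  shows "sobolev_W1p p (beta_version m \<beta> W) (layer_fun m \<beta> W l) (layer_grad m \<beta> W l)"
proof -
  interpret finite_measure "lebesgue_on (beta_version m \<beta> W)"
    by (rule finite_measure_lebesgue_on[OF beta_version_lmeasurable])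
  have [measurable]: "layer_fun m \<beta> W l \<in> borel_measurable (lebesgue_on (beta_version m \<beta> W))"
    "layer_grad m \<beta> W l \<in> borel_measurable (lebesgue_on (beta_version m \<beta> W))"
    by (intro measurable_restrict_space1 layer_fun_measurable layer_grad_measurable)+
  \<comment> \<open>The number of cubes is a crude bound, but on a set of finite measure any
    constant bound gives integrability.\<close>
  have bu: "\<bar>layer_fun m \<beta> W l y\<bar> \<le> real (card {x. cube x l \<in> W})" for y
  proof -
    have "\<bar>layer_fun m \<beta> W l y\<bar> = layer_fun m \<beta> W l y"
      by (simp add: layer_fun_def sum_nonneg chamber_fun_bounds)
    also have "\<dots> \<le> real (card {x. cube x l \<in> W}) * 1"
      unfolding layer_fun_def by (intro sum_bounded_above chamber_fun_bounds)
    finally show ?thesis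
      by simp
  qed
  have bg: "norm (layer_grad m \<beta> W l y) \<le> 1 / passage_width \<beta> l" for y
    unfolding norm_layer_grad using l
    by (intro divide_right_mono) (auto simp: indicator_def passage_width_def)
  have "in_Lp p (beta_version m \<beta> W) (layer_fun m \<beta> W l)"
    unfolding in_Lp_def
    by (intro conjI integrable_const_bound[of _ "real (card {x. cube x l \<in> W}) powr p"] AE_I2)
      (use assms bu in \<open>auto intro!: powr_mono2\<close>)
  moreover have "in_Lp p (beta_version m \<beta> W) (layer_grad m \<beta> W l)"
    unfolding in_Lp_def
    by (intro conjI integrable_const_bound[of _ "(1 / passage_width \<beta> l) powr p"] AE_I2)
      (use assms bg in \<open>auto intro!: powr_mono2\<close>)
  ultimately show ?thesis
    by (simp add: sobolev_W1p_def weak_gradient_layer_fun)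
qed

text \<open>With \<open>h\<close> the passage width, the gradient has norm \<open>1 / h\<close> on
  the union of the passages and vanishes elsewhere; \<open>measure_passage_le\<close> bounds the
  volume of the union.\<close>

lemma Lp_norm_layer_grad_le:
  assumes "0 < p" "{x. cube x l \<in> W} \<noteq> {}"
  shows "Lp_norm p (beta_version m \<beta> W) (layer_grad m \<beta> W l) \<le>
    (real (card {x. cube x l \<in> W}) * (2 * passage_width \<beta> l) ^ CARD('n) * passage_width \<beta> l powr (- p)) powr (1 / p)"
proof -
  define h where "h = passage_width \<beta> l"
  define U where "U = (\<Union>x\<in>{x. cube x l \<in> W}. passage m \<beta> x l)"
  \<comment> \<open>The bound \<open>l \<le> 4\<close> behind \<open>passage_width_bounds\<close>
    comes from a cube of the layer.\<close>
  obtain x0 where "cube x0 l \<in> W"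
    using assms(2) by blast
  then have h: "0 < h"
    unfolding h_def by (intro passage_width_bounds[OF l layer_side_le_4 \<beta>])
  have "U \<in> lmeasurable"
    unfolding U_def using fin by (intro fmeasurable.finite_UN) (auto simp: passage_eq_box)
  have eq: "norm (layer_grad m \<beta> W l y) powr p = h powr (- p) * indicator U y" for y
    using assms h by (simp add: norm_layer_grad U_def[symmetric] h_def[symmetric] indicator_def powr_minus
        powr_divide inverse_eq_divide)
  have "integral\<^sup>L (lebesgue_on (beta_version m \<beta> W)) (\<lambda>y. norm (layer_grad m \<beta> W l y) powr p)
      = integral\<^sup>L lebesgue (\<lambda>y. indicator (beta_version m \<beta> W) y *\<^sub>R (norm (layer_grad m \<beta> W l y) powr p))"
    using beta_version_lmeasurable by (intro integral_restrict_space) auto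
  also have "\<dots> \<le> integral\<^sup>L lebesgue (\<lambda>y. h powr (- p) * indicator U y)"
    using \<open>U \<in> lmeasurable\<close>
    by (intro integral_mono' integrable_mult_right) (auto simp: eq fmeasurable_def split: split_indicator)
  also have "\<dots> = h powr (- p) * measure lebesgue U"
    using \<open>U \<in> lmeasurable\<close> by (simp add: fmeasurable_def)
  also have "measure lebesgue U \<le> (\<Sum>x | cube x l \<in> W. measure lebesgue (passage m \<beta> x l))"
    unfolding U_def using fin by (intro measure_UNION_le) (auto simp: passage_eq_box)
  also have "\<dots> \<le> real (card {x. cube x l \<in> W}) * (2 * h) ^ CARD('n)"
    unfolding h_def using h by (intro sum_bounded_above measure_passage_le) (simp add: h_def)
  finally have "integral\<^sup>L (lebesgue_on (beta_version m \<beta> W)) (\<lambda>y. norm (layer_grad m \<beta> W l y) powr p)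
      \<le> real (card {x. cube x l \<in> W}) * (2 * h) ^ CARD('n) * h powr (- p)"
    using h by (simp add: mult_left_mono mult.commute)
  then show ?thesis
    unfolding Lp_norm_def h_def using assms by (intro powr_mono2) auto
qed

text \<open>Serves both for the rooms and for the corners.\<close>

lemma measure_UN_layer:
  assumes "\<And>x. cube x l \<in> W \<Longrightarrow> E x \<subseteq> interior (cube x l)" "\<And>x. E x \<in> lmeasurable"
    and "\<And>x. measure lebesgue (E x) = a"
  shows "measure lebesgue (\<Union>x\<in>{x. cube x l \<in> W}. E x) = real (card {x. cube x l \<in> W}) * a"
proof -
  have "pairwise (\<lambda>x x'. disjnt (E x) (E x')) {x. cube x l \<in> W}"
    using layer_interiors_disjoint assms(1) unfolding pairwise_def disjnt_def disjoint_family_on_def by blast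
  then show ?thesis
    using measure_UNION'[OF fin, of E lebesgue] assms by simp
qed

lemma room_subset_interior_cube: "cube x l \<in> W \<Longrightarrow> room x l \<subseteq> interior (cube x l)"
  using chamber_subset_interior_cube[OF l layer_side_le_4 \<beta>, of x m x] by (auto simp: chamber_def)

text \<open>No estimate of the average is needed: whatever the constant \<open>c\<close>, the function differs from it
  by at least \<open>1/2\<close> either on all rooms or on all corners of the layer.\<close>

lemma Lp_norm_layer_fun_ge:
  assumes "0 < q" and f: "in_Lp q (beta_version m \<beta> W) (\<lambda>y. layer_fun m \<beta> W l y - c)"
  shows "(real (card {x. cube x l \<in> W}) * (l / 4) ^ CARD('n) * (1 / 2) powr q) powr (1 / q) \<le>
    Lp_norm q (beta_version m \<beta> W) (\<lambda>y. layer_fun m \<beta> W l y - c)"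
proof -
  define D where "D = beta_version m \<beta> W"
  define E where "E = (\<lambda>x::real^'n. if c \<le> 1 / 2 then room x l else corner x l)"
  define U where "U = (\<Union>x\<in>{x. cube x l \<in> W}. E x)"
  have ap: "apartment m \<beta> x l \<subseteq> D" if "cube x l \<in> W" for x
    using that l by (auto simp: D_def beta_version_def)
  have Eint: "E x \<subseteq> interior (cube x l)" if "cube x l \<in> W" for x
    using room_subset_interior_cube[OF that] corner_subset[OF l, of x m \<beta>] by (auto simp: E_def)
  have "E x \<subseteq> D" if "cube x l \<in> W" for x
    using ap[OF that] room_subset_apartment[OF l, of x m \<beta>] corner_subset[OF l, of x m \<beta>]
      cube_Int_exterior_subset_apartment[of x l m \<beta>] interior_subset[of "cube x l"]
    unfolding E_def by (simp only: split: if_split) blast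
  then have "U \<subseteq> D"
    by (auto simp: U_def)
  have Elm: "E x \<in> lmeasurable" for x
    by (simp add: E_def room_eq_box corner_def)
  have "measure lebesgue (E x) = (l / 4) ^ CARD('n)" for x
    using measure_room[OF l, of x] measure_corner[OF l, of x] by (simp add: E_def)
  with Eint Elm have mU: "measure lebesgue U = real (card {x. cube x l \<in> W}) * (l / 4) ^ CARD('n)"
    unfolding U_def by (intro measure_UN_layer)
  have Ulm: "U \<in> lmeasurable"
    unfolding U_def using fin Elm by (intro fmeasurable.finite_UN) auto
  have half: "1 / 2 \<le> \<bar>layer_fun m \<beta> W l y - c\<bar>" if yU: "y \<in> U" for y
  proof -
    obtain x where x: "cube x l \<in> W" "y \<in> E x"
      using yU by (auto simp: U_def)
    then have eq: "layer_fun m \<beta> W l y = chamber_fun m \<beta> x l y"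
      using Eint by (intro layer_fun_eq_chamber_fun) auto
    show ?thesis
    proof (cases "c \<le> 1 / 2")
      case True
      then show ?thesis
        using x chamber_fun_room[OF l layer_side_le_4[OF x(1)] \<beta>, of y x m] by (simp add: eq E_def)
    next
      case False
      then have "y \<in> exterior m \<beta> x l"
        using x corner_subset[OF l, of x m \<beta>] by (auto simp: E_def)
      then show ?thesis
        using False chamber_fun_exterior[OF l layer_side_le_4[OF x(1)] \<beta>, of y m x] by (simp add: eq)
    qed
  qed
  \<comment> \<open>Monotonicity of the integral needs the larger function to be integrable, as a
    non-integrable one has integral 0 by default. This is what \<open>f\<close> provides.\<close>
  have int: "integrable lebesgue (\<lambda>y. indicator D y *\<^sub>R (norm (layer_fun m \<beta> W l y - c) powr q))"
    using f beta_version_lmeasurable unfolding in_Lp_def D_def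
    by (subst (asm) integrable_restrict_space) auto
  have "(1 / 2) powr q * measure lebesgue U = integral\<^sup>L lebesgue (\<lambda>y. (1 / 2) powr q * indicator U y)"
    using Ulm by (simp add: fmeasurable_def)
  also have "\<dots> \<le> integral\<^sup>L lebesgue (\<lambda>y. indicator D y *\<^sub>R (norm (layer_fun m \<beta> W l y - c) powr q))"
  proof (rule integral_mono'[OF int])
    fix y
    show "(1 / 2) powr q * indicator U y \<le> indicator D y *\<^sub>R (norm (layer_fun m \<beta> W l y - c) powr q)"
      using half[of y] \<open>U \<subseteq> D\<close> assms(1)
      by (cases "y \<in> U") (auto simp: indicator_def intro!: powr_mono2)
  qed (auto simp: indicator_def)
  also have "\<dots> = integral\<^sup>L (lebesgue_on D) (\<lambda>y. norm (layer_fun m \<beta> W l y - c) powr q)"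
    unfolding D_def using beta_version_lmeasurable by (intro integral_restrict_space[symmetric]) auto
  finally show ?thesis
    unfolding Lp_norm_def D_def[symmetric] using l assms(1)
    by (intro powr_mono2) (auto simp: mU mult_ac)
qed

text \<open>The rooms are disjoint and lie in \<open>G\<close>; measuring them in place of the cubes
  costs only a factor 4^n. The bound is used to show that \<open>lam\<close> is at most the
  dimension.\<close>

lemma layer_volume_le:
  assumes "G \<in> lmeasurable"
  shows "real (card {x. cube x l \<in> W}) * (l / 4) ^ CARD('n) \<le> measure lebesgue G"
proof -
  have "measure lebesgue (\<Union>x\<in>{x. cube x l \<in> W}. room x l) = real (card {x. cube x l \<in> W}) * (l / 4) ^ CARD('n)"
    by (intro measure_UN_layer room_subset_interior_cube measure_room[OF l]) (auto simp: room_eq_box)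
  moreover have "(\<Union>x\<in>{x. cube x l \<in> W}. room x l) \<subseteq> G"
  proof -
    have "cube x l \<subseteq> G" if "cube x l \<in> W" for x
      using W that unfolding whitney_def by blast
    then show ?thesis
      using room_subset_interior_cube interior_subset by blast
  qed
  then have "measure lebesgue (\<Union>x\<in>{x. cube x l \<in> W}. room x l) \<le> measure lebesgue G"
    using assms by (intro measure_mono_fmeasurable) (auto simp: room_eq_box intro!: sets_completionI_sets borel_open open_UN)
  ultimately show ?thesis
    by simp
qed

end

lemma card_whitney_layer:
  "card (whitney_layer W k) = card {x. cube x (1 / 2 ^ k) \<in> W}"
proof -
  have "whitney_layer W k = (\<lambda>x. cube x (1 / 2 ^ k)) ` {x. cube x (1 / 2 ^ k) \<in> W}"
    by (auto simp: whitney_layer_def)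
  moreover have "inj_on (\<lambda>x. cube x (1 / 2 ^ k)) {x. cube x (1 / 2 ^ k) \<in> W}"
    using cube_inject(1)[of "1 / 2 ^ k" "1 / 2 ^ k"] by (auto simp: inj_on_def)
  ultimately show ?thesis
    by (simp add: card_image)
qed

section \<open>Comparison of exponents\<close>

text \<open>Here \<open>N\<close> counts cubes and \<open>h\<close> is the passage width. Cancelling
  \<open>N powr (1 / p)\<close> leaves \<open>N\<close> to the power \<open>1 / q - 1 / p\<close>,
  positive since \<open>q < p\<close>; so the lower bound on \<open>N\<close> can be inserted, and
  only a power of \<open>l\<close> remains.\<close>

lemma powr_estimate:
  fixes N l h c q p \<beta> lam \<epsilon> :: real and n :: nat
  assumes "0 < \<epsilon>" "0 < l" "0 \<le> c" "0 < \<beta>" "1 \<le> q" "q < p"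
    and N: "\<epsilon> \<le> N * l powr lam"
    and h: "h = (l / 8) powr (1 / \<beta>)"
    and le: "(N * (l / 4) ^ n * (1 / 2) powr q) powr (1 / q) \<le> c * (N * (2 * h) ^ n * h powr (- p)) powr (1 / p)"
  shows "\<epsilon> powr (1 / q - 1 / p) \<le>
    c * 2 * 2 powr (n / p) * 4 powr (n / q) * 8 powr (- ((n - p) / (\<beta> * p))) *
      l powr (lam * (1 / q - 1 / p) + (n - p) / (\<beta> * p) - n / q)"
proof -
  define a where "a = 1 / q - 1 / p"
  \<comment> \<open>\<open>s\<close> is the exponent for which
    \<open>h powr (n / p - 1) = (l / 8) powr s\<close>.\<close>
  define s where "s = (n - p) / (\<beta> * p)"
  have a: "0 < a"
    using assms by (simp add: a_def frac_less2)
  have "0 < h"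
    using h assms by simp
  have "0 < N * l powr lam"
    using N assms by linarith
  then have "0 < N"
    using assms by (simp add: zero_less_mult_iff)
  have "(N * (l / 4) ^ n * (1 / 2) powr q) powr (1 / q) = N powr (1 / q) * (l powr (n / q) / 4 powr (n / q)) * (1 / 2)"
    using assms \<open>0 < N\<close> by (simp add: powr_mult powr_powr powr_divide powr_realpow[symmetric])
  moreover have "(N * (2 * h) ^ n * h powr (- p)) powr (1 / p) = N powr (1 / p) * 2 powr (n / p) * (h powr (n / p) * h powr (- 1))"
    using assms(5,6) \<open>0 < N\<close> \<open>0 < h\<close> by (simp add: powr_mult powr_powr powr_realpow[symmetric])
  moreover have "h powr (n / p) * h powr (- 1) = l powr s * 8 powr (- s)"
  proof -
    have "h powr (n / p) * h powr (- 1) = h powr (n / p - 1)"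
      by (simp only: powr_add[symmetric]) simp
    also have "\<dots> = (l / 8) powr (1 / \<beta> * (n / p - 1))"
      using assms by (simp add: h powr_powr)
    also have "1 / \<beta> * (n / p - 1) = s"
      using assms by (simp add: s_def field_simps)
    finally show ?thesis
      using assms(2) by (simp add: powr_divide powr_minus_divide)
  qed
  ultimately have "N powr (1 / q) * (l powr (n / q) / 4 powr (n / q)) * (1 / 2) \<le>
      c * (N powr (1 / p) * 2 powr (n / p) * (l powr s * 8 powr (- s)))"
    using le by (simp only:)
  moreover have "N powr (1 / q) = N powr a * N powr (1 / p)"
    by (simp add: a_def powr_add[symmetric])
  ultimately have "N powr (1 / p) * (N powr a * l powr (n / q)) \<le>
      N powr (1 / p) * (c * 2 * 2 powr (n / p) * 4 powr (n / q) * 8 powr (- s) * l powr s)"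
    by (simp add: field_simps)
  then have *: "N powr a * l powr (n / q) \<le> c * 2 * 2 powr (n / p) * 4 powr (n / q) * 8 powr (- s) * l powr s"
    using \<open>0 < N\<close> by simp
  have "\<epsilon> powr a \<le> (N * l powr lam) powr a"
    using N assms a by (intro powr_mono2) auto
  also have "\<dots> = N powr a * l powr (n / q) * l powr (lam * a - n / q)"
    using assms \<open>0 < N\<close> by (simp add: powr_mult powr_powr powr_diff)
  also have "\<dots> \<le> c * 2 * 2 powr (n / p) * 4 powr (n / q) * 8 powr (- s) * l powr s * l powr (lam * a - n / q)"
    using * by (intro mult_right_mono) auto
  also have "\<dots> = c * 2 * 2 powr (n / p) * 4 powr (n / q) * 8 powr (- s) * l powr (lam * a + s - n / q)"
    by (simp add: mult.assoc powr_add[symmetric] algebra_simps)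
  finally show ?thesis
    by (simp add: a_def s_def)
qed

text \<open>Multiplied by \<open>p * q * \<beta>\<close>, the exponent becomes
  \<open>q * (n - p) - \<beta> * (lam * q + p * (n - lam))\<close>. The hypothesis on
  \<open>p\<close> says that this is nonnegative with \<open>b\<close> for \<open>\<beta>\<close>;
  as the bracket is positive and \<open>\<beta> < b\<close>, it is positive.\<close>

lemma exponent_positive:
  fixes n lam b \<beta> p q :: real
  assumes "0 < n" "0 \<le> lam" "lam \<le> n" "1 \<le> q" "q < p" "0 < \<beta>" "\<beta> \<le> 1" and b: "b = 2 * \<beta> / (1 + \<beta>)"
    and p: "p \<le> q * (n - lam * b) / (q + b * (n - lam))"
  shows "0 < lam * (1 / q - 1 / p) + (n - p) / (\<beta> * p) - n / q"
proof -
  have "0 < b"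
    using assms by simp
  have "0 < q + b * (n - lam)"
    using assms \<open>0 < b\<close> by (simp add: add_pos_nonneg)
  with p have "p * (q + b * (n - lam)) \<le> q * (n - lam * b)"
    by (simp add: pos_le_divide_eq)
  then have le: "b * (lam * q + p * (n - lam)) \<le> q * (n - p)"
    by (simp add: algebra_simps)
  have pos: "0 < lam * q + p * (n - lam)"
  proof (cases "lam = n")
    case True
    then show ?thesis
      using assms by simp
  next
    case False
    then show ?thesis
      using assms by (intro add_nonneg_pos) auto
  qed
  \<comment> \<open>If \<open>\<beta> = 1\<close>, then \<open>b = 1\<close>, and
    \<open>lam * q + p * (n - lam) \<ge> q * n\<close> contradicts \<open>le\<close>.\<close>
  have "\<beta> < 1"
  proof (rule ccontr)
    assume "\<not> \<beta> < 1"
    then have "b = 1"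
      using assms by simp
    then have "lam * q + p * (n - lam) \<le> q * n - q * p"
      using le by (simp add: algebra_simps)
    moreover have "q * (n - lam) \<le> p * (n - lam)" "0 < q * p"
      using assms by (auto intro!: mult_right_mono)
    ultimately show False
      by (simp add: algebra_simps)
  qed
  then have "\<beta> * (1 + \<beta>) < 2 * \<beta>"
    using assms by simp
  then have "\<beta> < b"
    unfolding b using assms by (simp add: pos_less_divide_eq)
  then have "\<beta> * (lam * q + p * (n - lam)) < q * (n - p)"
    using le pos mult_strict_right_mono[OF \<open>\<beta> < b\<close> pos] by linarith
  moreover have "lam * (1 / q - 1 / p) + (n - p) / (\<beta> * p) - n / q =
      (q * (n - p) - \<beta> * (lam * q + p * (n - lam))) / (p * q * \<beta>)"
    using assms by (simp add: field_simps)
  ultimately show ?thesis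
    using assms by simp
qed

section \<open>Small cubes and the contradiction\<close>

lemma powr_half_power_tendsto_0:
  fixes K \<delta> :: real
  assumes "0 < \<delta>"
  shows "(\<lambda>k. K * (1 / 2 ^ k) powr \<delta>) \<longlonglongrightarrow> 0"
proof -
  have "(\<lambda>k. 1 / 2 ^ k :: real) \<longlonglongrightarrow> 0"
    using LIMSEQ_realpow_zero[of "1 / 2 :: real"] by (simp add: power_one_over)
  then have "(\<lambda>k. (1 / 2 ^ k :: real) powr \<delta>) \<longlonglongrightarrow> 0"
    using assms by (intro tendsto_zero_powrI[where b = \<delta>]) auto
  then show ?thesis
    using tendsto_mult_right_zero by blast
qed

theorem theorem4p7:
  fixes G :: "(real^'n) set" and W :: "(real^'n) set set" and m :: "'n::finite"
    and p q \<beta> b lam :: real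
  assumes "2 \<le> CARD('n)"
    and "john_domain G"
    and "diameter G \<le> 4"
    and "whitney G W"
    and "lam = enn2real (upper_minkowski_dim (frontier G))"
    and "limsup (\<lambda>k. ereal (2 powr (- lam * real k) * real (card (whitney_layer W k)))) > 0"
    and "1 \<le> q" and "q < p"
    and "0 < \<beta>" and "\<beta> \<le> 1"
    and "b = 2 * \<beta> / (1 + \<beta>)"
    and "p \<le> q * (real CARD('n) - lam * b) / (q + b * (real CARD('n) - lam))"
  shows "\<not> poincare q p (beta_version m \<beta> W)"
proof
  let ?I = "\<lambda>k. {x::real^'n. cube x (1 / 2 ^ k) \<in> W}"
  define D where "D = beta_version m \<beta> W"
  assume "poincare q p (beta_version m \<beta> W)"
  then obtain c0 where c0: "\<And>u g. sobolev_W1p p D u g \<Longrightarrow>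
      in_Lp q D (\<lambda>x. u x - average D u) \<and> Lp_norm q D (\<lambda>x. u x - average D u) \<le> c0 * Lp_norm p D g"
    unfolding poincare_def D_def by blast
  \<comment> \<open>The constant of the inequality may be negative, while
    \<open>powr_estimate\<close> wants a nonnegative one.\<close>
  define c where "c = \<bar>c0\<bar>"
  have G: "bounded G" "open G"
    using assms(2) by (auto simp: john_domain_def domain_def)
  then have "G \<in> lmeasurable"
    by (simp add: lmeasurable_open)

  \<comment> \<open>A positive upper limit exceeds some positive \<open>\<epsilon>\<close>, and the
    sequence then does so for infinitely many \<open>k\<close>.\<close>
  obtain \<epsilon> where \<epsilon>: "0 < \<epsilon>" "\<exists>\<^sub>F k in sequentially. \<epsilon> < real (card (?I k)) * (1 / 2 ^ k) powr lam"
  proof -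
    obtain e where e: "0 < ereal e" "ereal e < limsup (\<lambda>k. ereal (2 powr (- lam * real k) * real (card (whitney_layer W k))))"
      using ereal_dense2[OF assms(6)] by blast
    have "\<exists>\<^sub>F k in sequentially. ereal e < ereal (2 powr (- lam * real k) * real (card (whitney_layer W k)))"
      using Limsup_bounded[of "\<lambda>k. ereal (2 powr (- lam * real k) * real (card (whitney_layer W k)))" "ereal e" sequentially] e(2)
      by (auto simp: frequently_def not_less)
    moreover have "2 powr (- lam * real k) = (1 / 2 ^ k) powr lam" for k
      by (simp add: powr_divide powr_realpow[symmetric] powr_powr powr_minus_divide mult.commute)
    ultimately have "\<exists>\<^sub>F k in sequentially. e < real (card (?I k)) * (1 / 2 ^ k) powr lam"
      by (simp add: card_whitney_layer mult.commute)
    with e(1) that show ?thesis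
      by simp
  qed
  \<comment> \<open>As \<open>card\<close> is 0 on infinite sets, a positive count yields both
    finiteness and nonemptiness.\<close>
  have I: "finite (?I k)" "?I k \<noteq> {}" if "\<epsilon> < real (card (?I k)) * (1 / 2 ^ k) powr lam" for k
  proof -
    have "card (?I k) \<noteq> 0"
    proof
      assume "card (?I k) = 0"
      with that \<epsilon>(1) show False
        by simp
    qed
    then have "0 < card (?I k)"
      by simp
    then show "finite (?I k)" "?I k \<noteq> {}"
      unfolding card_gt_0_iff by simp_all
  qed

  \<comment> \<open>Otherwise the volume bound makes the count times \<open>l powr lam\<close> at
    most a constant times \<open>l powr (lam - CARD('n))\<close>, which tends to 0, against the
    lower bound \<open>\<epsilon>\<close>.\<close>
  have "lam \<le> CARD('n)"
  proof (rule ccontr)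
    assume "\<not> lam \<le> CARD('n)"
    then have "(\<lambda>k. measure lebesgue G * 4 ^ CARD('n) * (1 / 2 ^ k) powr (lam - CARD('n))) \<longlonglongrightarrow> 0"
      by (intro powr_half_power_tendsto_0) simp
    then have "\<forall>\<^sub>F k in sequentially. measure lebesgue G * 4 ^ CARD('n) * (1 / 2 ^ k) powr (lam - CARD('n)) < \<epsilon>"
      using \<epsilon>(1) by (rule order_tendstoD(2))
    then obtain k where k: "\<epsilon> < real (card (?I k)) * (1 / 2 ^ k) powr lam"
        "measure lebesgue G * 4 ^ CARD('n) * (1 / 2 ^ k) powr (lam - CARD('n)) < \<epsilon>"
      using frequently_ex[OF frequently_eventually_frequently[OF \<epsilon>(2)]] by auto
    define l :: real where "l = 1 / 2 ^ k"
    have l: "0 < l"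
      by (simp add: l_def)
    have "real (card (?I k)) * (l / 4) ^ CARD('n) \<le> measure lebesgue G"
      unfolding l_def using I(1)[OF k(1)] assms G \<open>G \<in> lmeasurable\<close>
      by (intro layer_volume_le[of G W _ \<beta>]) auto
    then have "real (card (?I k)) * l powr CARD('n) \<le> measure lebesgue G * 4 ^ CARD('n)"
      using l by (simp add: power_divide powr_realpow pos_divide_le_eq)
    then have "real (card (?I k)) * l powr CARD('n) * l powr (lam - CARD('n)) \<le> measure lebesgue G * 4 ^ CARD('n) * l powr (lam - CARD('n))"
      by (rule mult_right_mono) simp
    moreover have "l powr CARD('n) * l powr (lam - CARD('n)) = l powr lam"
      by (simp only: powr_add[symmetric]) simp
    ultimately have "real (card (?I k)) * l powr lam \<le> measure lebesgue G * 4 ^ CARD('n) * l powr (lam - CARD('n))"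
      by (simp only: mult.assoc)
    then show False
      using k unfolding l_def by linarith
  qed
  moreover have "0 \<le> lam"
    by (simp add: assms(5))
  ultimately have \<delta>: "0 < lam * (1 / q - 1 / p) + (CARD('n) - p) / (\<beta> * p) - CARD('n) / q" (is "0 < ?\<delta>")
    using assms by (intro exponent_positive[of _ _ _ _ _ b]) auto
  \<comment> \<open>\<open>K\<close> gathers the factors in \<open>powr_estimate\<close> that do not
    depend on \<open>l\<close>.\<close>
  define K where "K = c * 2 * 2 powr (CARD('n) / p) * 4 powr (CARD('n) / q) * 8 powr (- ((CARD('n) - p) / (\<beta> * p)))"
  have "\<forall>\<^sub>F k in sequentially. K * (1 / 2 ^ k) powr ?\<delta> < \<epsilon> powr (1 / q - 1 / p)"
    using \<epsilon>(1) by (intro order_tendstoD(2)[OF powr_half_power_tendsto_0[OF \<delta>]]) simp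
  \<comment> \<open>The second bound holds for all large \<open>k\<close> because the exponent is
    positive, the first for infinitely many; hence a common \<open>k\<close>.\<close>
  then obtain k where k: "\<epsilon> < real (card (?I k)) * (1 / 2 ^ k) powr lam"
      "K * (1 / 2 ^ k) powr ?\<delta> < \<epsilon> powr (1 / q - 1 / p)"
    using frequently_ex[OF frequently_eventually_frequently[OF \<epsilon>(2)]] by auto
  define l :: real where "l = 1 / 2 ^ k"
  have l: "0 < l"
    by (simp add: l_def)
  let ?N = "real (card {x. cube x l \<in> W})"
  have fin: "finite {x. cube x l \<in> W}" and ne: "{x. cube x l \<in> W} \<noteq> {}"
    using I[OF k(1)] by (auto simp: l_def)
  note layer = assms(4) G(1) assms(3) l assms(9,10) fin
  let ?u = "layer_fun m \<beta> W l" and ?g = "layer_grad m \<beta> W l"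
  have pq: "0 < p" "0 < q"
    using assms by auto
  have "sobolev_W1p p D ?u ?g"
    unfolding D_def by (rule sobolev_layer_fun[OF layer pq(1)])
  from c0[OF this] have Lq: "in_Lp q D (\<lambda>x. ?u x - average D ?u)"
    and le: "Lp_norm q D (\<lambda>x. ?u x - average D ?u) \<le> c0 * Lp_norm p D ?g"
    by auto
  \<comment> \<open>The lower bound holds for every constant subtracted, in particular for the
    average.\<close>
  have "(?N * (l / 4) ^ CARD('n) * (1 / 2) powr q) powr (1 / q) \<le> Lp_norm q D (\<lambda>x. ?u x - average D ?u)"
    using Lq unfolding D_def by (rule Lp_norm_layer_fun_ge[OF layer pq(2)])
  also note le
  also have "c0 * Lp_norm p D ?g \<le> c * Lp_norm p D ?g"
    by (intro mult_right_mono) (auto simp: c_def Lp_norm_def)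
  also have "\<dots> \<le> c * (?N * (2 * passage_width \<beta> l) ^ CARD('n) * passage_width \<beta> l powr (- p)) powr (1 / p)"
    unfolding D_def using Lp_norm_layer_grad_le[OF layer pq(1) ne] by (intro mult_left_mono) (auto simp: c_def)
  finally have "(?N * (l / 4) ^ CARD('n) * (1 / 2) powr q) powr (1 / q) \<le>
      c * (?N * (2 * passage_width \<beta> l) ^ CARD('n) * passage_width \<beta> l powr (- p)) powr (1 / p)" .
  then have "\<epsilon> powr (1 / q - 1 / p) \<le> K * l powr ?\<delta>"
    unfolding K_def using k(1) \<epsilon>(1) l assms
    by (intro powr_estimate) (auto simp: c_def l_def passage_width_def)
  with k(2) show False
    by (simp add: l_def)
qed

end
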